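(* Let the Gaussian fully connected network, the inputs $\{x_\alpha\}_{\alpha\in A}$, and all the notation be as in the context, and assume: (i) $\sigma$ is continuous and bounded; (ii) there exist $\widehat{\ell}\in\{1,\ldots,L\}$ and $\gamma_1,\ldots,\gamma_L\in[1,\infty]$ such that $\lim_{n\to\infty}n_\ell(n)/n_{\widehat{\ell}}(n)=\gamma_\ell$ for all $\ell=1,\ldots,L$; set $v_n^*:=n_{\widehat{\ell}}(n)$. Then, for every sequence of positive numbers $\{a_n\}_n$ with $a_n\to0$ and $a_nv_n^*\to\infty$, the sequence $\{(\sqrt{a_n}Z_h^{(L+1)}(x_\alpha))_{\alpha\in A,\,h=1,\ldots,n_{L+1}}\}_n$ satisfies the large deviation principle on $\mathbb{R}^{|A|\times n_{L+1}}$ with speed $1/a_n$ and good rate function $$\widetilde{I}_{Z^{(L+1)}(\underline{x})}(z):=\inf_{r\in\mathbb{R}^{|A|\times n_{L+1}}}\{\|r\|^2/2:\ \widehat{g}^{(L),\#}_{\underline{x}}r=z\},$$ where $\|\cdot\|$ is the Euclidean norm and $\widehat g^{(L),\#}_{\underline{x}}r=(\sum_{\gamma}\widehat g^{(L),\#}_{\underline{x},\alpha\gamma}r_{\gamma h})_{\alpha h}$. In particular, if $\widehat{g}^{(L)}_{\underline{x}}$ is invertible, then $\widetilde{I}_{Z^{(L+1)}(\underline{x})}(z)=\|(\widehat g^{(L),\#}_{\underline{x}})^{-1}z\|^2/2$.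
   Context: Fix integers $L\ge1$, $n_0\ge1$, $n_{L+1}\ge1$, constants $C_b\ge0$, $C_W>0$ and a function $\sigma:\mathbb{R}\to\mathbb{R}$. For each $n\ge1$ let $n_1(n),\ldots,n_L(n)$ be positive integers with $n_\ell(n)\to\infty$ as $n\to\infty$ (write $n_\ell=n_\ell(n)$). The network is defined, for $x=(x_1,\ldots,x_{n_0})\in\mathbb{R}^{n_0}$, by $Z_i^{(1)}(x)=b_i^{(1)}+\sum_{r=1}^{n_0}W^{(1)}_{ir}x_r$ ($i=1,\ldots,n_1$) and $Z_i^{(\ell+1)}(x)=b_i^{(\ell+1)}+\sum_{j=1}^{n_\ell}W^{(\ell+1)}_{ij}\sigma(Z_j^{(\ell)}(x))$ ($i=1,\ldots,n_{\ell+1}$, $1\le\ell\le L$), where all biases $b_i^{(\ell)}$ are centered Normal with variance $C_b$ (degenerate at $0$ if $C_b=0$), all weights $W_{ij}^{(\ell+1)}$ ($0\le\ell\le L$) are centered Normal with variance $C_W/n_\ell$, and all these random variables are independent. Let $A$ be a finite set and $x_\alpha=(x_{\alpha,1},\ldots,x_{\alpha,n_0})\in\mathbb{R}^{n_0}$, $\alpha\in A$, fixed inputs; $\underline{x}$ denotes $\{x_\alpha\}_{\alpha\in A}$. For a symmetric positive semidefinite $A\times A$ matrix $q$, $q^\#$ is its unique symmetric positive semidefinite square root. $\mathbf{1}$ is the $A\times A$ all-ones matrix. Let $(N_\gamma)_{\gamma\in A}$ be i.i.d. standard Normal and $y(q)$ the $A\times A$ matrix with entries $y_{\alpha\beta}(q):=\mathbb{E}[\sigma(\sum_{\gamma}q^\#_{\alpha\gamma}N_\gamma)\sigma(\sum_\gamma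 q^\#_{\beta\gamma}N_\gamma)]$. Define $\widehat g^{(0)}_{\underline{x}}$ as the matrix with entries $C_b+\frac{C_W}{n_0}\sum_{r=1}^{n_0}x_{\alpha,r}x_{\beta,r}$, and recursively $\widehat g^{(\ell)}_{\underline{x}}:=C_b\mathbf{1}+C_W\,y(\widehat g^{(\ell-1)}_{\underline{x}})$ for $\ell=1,\ldots,L$. A sequence satisfies the LDP with speed $v_n\to\infty$ and rate function $I$ if $\limsup\frac1{v_n}\log P(\cdot\in C)\le-\inf_C I$ for closed $C$ and $\liminf\frac1{v_n}\log P(\cdot\in O)\ge-\inf_O I$ for open $O$; $I$ is good if its sublevel sets are compact. *)

theory Defs
  imports "HOL-Probability.Probability"
begin

text \<open>Bias l i is the bias of neuron i (0-based) in layer l (l = 1..L+1);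
  Weight l i j is the weight from neuron j of layer l-1 to neuron i of layer l.\<close>
datatype param = Bias nat nat | Weight nat nat nat

text \<open>Set of all parameters of the network, for widths w (w 0 = n_0, w (L+1) = n_{L+1}).\<close>
definition params :: "nat \<Rightarrow> (nat \<Rightarrow> nat) \<Rightarrow> param set" where
  "params L w =
     {Bias l i | l i. 1 \<le> l \<and> l \<le> Suc L \<and> i < w l} \<union>
     {Weight l i j | l i j. 1 \<le> l \<and> l \<le> Suc L \<and> i < w l \<and> j < w (l - 1)}"

definition param_var :: "real \<Rightarrow> real \<Rightarrow> (nat \<Rightarrow> nat) \<Rightarrow> param \<Rightarrow> real" where
  "param_var Cb CW w p = (case p of Bias l i \<Rightarrow> Cb | Weight l i j \<Rightarrow> CW / real (w (l - 1)))"

definition centered_normal :: "real \<Rightarrow> real measure" where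
  "centered_normal v = (if v = 0 then return borel 0 else density lborel (normal_density 0 (sqrt v)))"

text \<open>Pre-activations Z^{(l)}_i(x) for l = 1..L+1, given parameter values th, widths w,
  activation sg and input x (coordinates x 0 .. x (w 0 - 1)).\<close>
fun preact :: "(param \<Rightarrow> real) \<Rightarrow> (nat \<Rightarrow> nat) \<Rightarrow> (real \<Rightarrow> real) \<Rightarrow> (nat \<Rightarrow> real)
                 \<Rightarrow> nat \<Rightarrow> nat \<Rightarrow> real" where
  "preact th w sg x 0 i = 0"
| "preact th w sg x (Suc 0) i = th (Bias 1 i) + (\<Sum>r<w 0. th (Weight 1 i r) * x r)"
| "preact th w sg x (Suc (Suc l)) i =
     th (Bias (Suc (Suc l)) i) +
     (\<Sum>j<w (Suc l). th (Weight (Suc (Suc l)) i j) * sg (preact th w sg x (Suc l) j))"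

definition psd_mat :: "real^'a^'a \<Rightarrow> bool" where
  "psd_mat S \<longleftrightarrow> (\<forall>v. 0 \<le> v \<bullet> (S *v v))"

definition psd_sqrt :: "real^'a^'a \<Rightarrow> real^'a^'a" where
  "psd_sqrt q = (THE s. transpose s = s \<and> psd_mat s \<and> s ** s = q)"

definition y_mat :: "(real \<Rightarrow> real) \<Rightarrow> real^'a^'a \<Rightarrow> real^'a^'a" where
  "y_mat sg q = (\<chi> a b. integral\<^sup>L lborel
      (\<lambda>N::real^'a. (\<Prod>c\<in>UNIV. std_normal_density (N $ c)) *
          (sg ((psd_sqrt q *v N) $ a) * sg ((psd_sqrt q *v N) $ b))))"

definition ghat0 :: "real \<Rightarrow> real \<Rightarrow> nat \<Rightarrow> ('a \<Rightarrow> nat \<Rightarrow> real) \<Rightarrow> real^'a^'a" where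
  "ghat0 Cb CW n0 x = (\<chi> a b. Cb + CW / real n0 * (\<Sum>r<n0. x a r * x b r))"

fun ghat :: "real \<Rightarrow> real \<Rightarrow> (real \<Rightarrow> real) \<Rightarrow> nat \<Rightarrow> ('a \<Rightarrow> nat \<Rightarrow> real) \<Rightarrow> nat \<Rightarrow> real^'a^'a" where
  "ghat Cb CW sg n0 x 0 = ghat0 Cb CW n0 x"
| "ghat Cb CW sg n0 x (Suc l) = (\<chi> a b. Cb + CW * y_mat sg (ghat Cb CW sg n0 x l) $ a $ b)"

definition mat_act :: "real^'a::finite^'a \<Rightarrow> real^('a \<times> 'k::finite) \<Rightarrow> real^('a \<times> 'k)" where
  "mat_act S r = (\<chi> p. \<Sum>c\<in>UNIV. S $ fst p $ c * r $ (c, snd p))"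

definition eln :: "real \<Rightarrow> ereal" where
  "eln p = (if p > 0 then ereal (ln p) else -\<infinity>)"

definition LDP :: "(nat \<Rightarrow> 'x::topological_space measure) \<Rightarrow> (nat \<Rightarrow> real) \<Rightarrow> ('x \<Rightarrow> ereal) \<Rightarrow> bool" where
  "LDP \<mu> v I \<longleftrightarrow>
     (\<forall>C. closed C \<longrightarrow>
        limsup (\<lambda>n. ereal (1 / v n) * eln (measure (\<mu> n) C)) \<le> - (INF z\<in>C. I z)) \<and>
     (\<forall>U. open U \<longrightarrow>
        liminf (\<lambda>n. ereal (1 / v n) * eln (measure (\<mu> n) U)) \<ge> - (INF z\<in>U. I z))"

definition good_rate_function :: "('x::topological_space \<Rightarrow> ereal) \<Rightarrow> bool" where
  "good_rate_function I \<longleftrightarrow>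
     (\<forall>z. 0 \<le> I z) \<and> (\<forall>c::real. closed {z. I z \<le> ereal c}) \<and>
     (\<forall>c::real. compact {z. I z \<le> ereal c})"

end

theory Submission
  imports Defs
begin

text \<open>
  Conditionally on the first \<open>L\<close> layers, the output is a centered Gaussian vector whose covariance
  is the empirical matrix \<open>q = Cb + CW / n\<^sub>L \<Sum>\<^sub>j \<sigma>(Z\<^sub>j) \<sigma>(Z\<^sub>j)\<close>; it therefore has the law of
  \<open>q\<^sup># R\<close> with \<open>R\<close> standard Gaussian. Since \<open>\<sigma>\<close> is bounded, Hoeffding's inequality applied conditionally
  layer by layer, together with the continuity of \<open>q \<mapsto> q\<^sup>#\<close> and of the covariance recursion, shows that the
  empirical matrix deviates from its deterministic limit \<open>g\<close> with probability at most
  \<open>C exp(- c n*)\<close>, where \<open>n*\<close> is the smallest width. This is negligible at the slower speed \<open>1 / a\<close>, so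
  the output behaves like \<open>g\<^sup># R\<close>: if \<open>\<surd>a R\<close> lies in a ball of radius \<open>\<surd>(2 M)\<close>, then \<open>q\<^sup># \<surd>a R\<close> lies
  close to the sublevel set \<open>{I \<le> M}\<close>, and the upper bound is a tail bound for \<open>R\<close>; the lower bound is
  a lower bound on the Gaussian density near a point.
\<close>

section \<open>Square roots of positive semidefinite matrices\<close>

text \<open>The matrix \<open>q\<close> may be singular, so the conditional output need not have a
  density. Its law is therefore identified through characteristic functions, which see only the
  covariance, and the multivariate uniqueness theorem is deduced from the one-dimensional one.
  Realising every conditional law as an image of the same Gaussian vector \<open>R\<close> makes
  different \<open>q\<close> comparable: replacing \<open>q\<close> by \<open>g\<close> moves the
  output by at most a small multiple of the norm of \<open>R\<close>, and what remains to be
  estimated is one fixed measure.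

  The square root must be continuous at singular matrices too, where no Lipschitz bound holds; a
  Hoelder estimate of exponent 1/2 covers them. Since all width ratios tend to limits \<gamma> \<ge>
  1, every hidden width is eventually at least half of \<open>nw n lhat\<close>, so each Hoeffding
  exponent is at least a fixed multiple of that width. As \<open>a n * nw n lhat\<close> tends to
  infinity, the failure probability then drops below every \<open>exp (- E / a n)\<close>.\<close>

text \<open>A maximiser of the Rayleigh quotient on the unit sphere of \<open>S\<close> is an
  eigenvector, because the first variation of the quotient in the direction of the residual
  \<open>f e - l e\<close> must vanish. Working inside an invariant subspace allows new eigenvectors
  to be found orthogonal to old ones.\<close>

lemma selfadjoint_eigenvector:
  fixes f :: "'n::euclidean_space \<Rightarrow> 'n"
  assumes lin: "linear f" and sa: "\<And>x y. f x \<bullet> y = x \<bullet> f y"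
    and S: "subspace S" "\<And>x. x \<in> S \<Longrightarrow> f x \<in> S" and ne: "z \<in> S" "z \<noteq> 0"
  obtains e l where "e \<in> S" "norm e = 1" "f e = l *\<^sub>R e"
proof -
  let ?K = "S \<inter> sphere 0 1"
  have contf: "continuous_on UNIV f"
    using lin by (simp add: linear_continuous_on linear_linear)
  have "compact ?K"
    using closed_subspace[OF S(1)] compact_sphere by (rule closed_Int_compact)
  moreover have "z /\<^sub>R norm z \<in> ?K"
    using S(1) ne by (auto intro: subspace_scale)
  moreover have "continuous_on ?K (\<lambda>x. x \<bullet> f x)"
    by (intro continuous_intros continuous_on_subset[OF contf]) auto
  ultimately obtain e where e: "e \<in> ?K" and max: "\<And>y. y \<in> ?K \<Longrightarrow> y \<bullet> f y \<le> e \<bullet> f e"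
    using continuous_attains_sup[of ?K "\<lambda>x. x \<bullet> f x"] by blast
  define l where "l = e \<bullet> f e"
  have ee: "e \<bullet> e = 1" using e by (simp add: dot_square_norm)
  have le: "y \<bullet> f y \<le> l * (y \<bullet> y)" if "y \<in> S" for y
  proof (cases "y = 0")
    case True then show ?thesis by simp
  next
    case False
    have "(y /\<^sub>R norm y) \<bullet> f (y /\<^sub>R norm y) \<le> l"
      unfolding l_def using that False S(1) by (intro max) (auto intro: subspace_scale)
    then have "(y \<bullet> f y) / (norm y)^2 \<le> l"
      using lin by (simp add: linear_scale power2_eq_square field_simps)
    then show ?thesis using False
      by (simp add: field_simps power2_norm_eq_inner)
  qed
  define d where "d = f e - l *\<^sub>R e"
  have dS: "d \<in> S" unfolding d_def using S e by (auto intro: subspace_diff subspace_scale)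
  have ed: "e \<bullet> d = 0" by (simp add: d_def inner_diff_right ee l_def)
  have fe: "f e = d + l *\<^sub>R e" by (simp add: d_def)
  have dfe: "d \<bullet> f e = d \<bullet> d" using ed by (simp add: fe inner_add_right inner_commute)
  define A where "A = d \<bullet> d"
  define B where "B = d \<bullet> f d - l * (d \<bullet> d)"
  \<comment> \<open>Maximality tested at \<open>e + t d\<close>. The linear coefficient is twice the
    squared norm of the residual, and letting \<open>t\<close> be small and positive forces it to be
    zero.\<close>
  have key: "2 * t * A + t^2 * B \<le> 0" for t
  proof -
    have "e + t *\<^sub>R d \<in> S" using e dS S(1) by (auto intro: subspace_add subspace_scale)
    from le[OF this] have
      "l + 2 * t * (d \<bullet> f e) + t^2 * (d \<bullet> f d) \<le> l * (1 + t^2 * (d \<bullet> d))"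
      using ed ee sa[of d e] lin
      by (simp add: linear_add linear_scale inner_add_left inner_add_right inner_commute l_def
          power2_eq_square algebra_simps)
    then show ?thesis by (simp add: dfe A_def B_def algebra_simps)
  qed
  have "A = 0"
  proof (rule ccontr)
    assume "A \<noteq> 0"
    then have A: "A > 0" unfolding A_def using inner_ge_zero[of d] by linarith
    \<comment> \<open>Small enough that \<open>t * \<bar>B\<bar> \<le> A\<close>, so the quadratic
      term cannot cancel \<open>2 * A\<close>.\<close>
    define t where "t = A / (\<bar>B\<bar> + 1)"
    have t: "t > 0" "t * (\<bar>B\<bar> + 1) = A" using A by (auto simp: t_def)
    have "t * (2 * A + t * B) \<le> 0" using key[of t] by (simp add: power2_eq_square algebra_simps)
    then have "2 * A + t * B \<le> 0" using t(1) by (simp add: mult_le_0_iff)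
    moreover have "t * B \<ge> - (t * \<bar>B\<bar>)" using t(1)
      by (metis abs_ge_minus_self abs_mult abs_of_pos minus_le_iff)
    moreover have "t * \<bar>B\<bar> \<le> A" using t by (simp add: algebra_simps)
    ultimately show False using A by linarith
  qed
  then have "d = 0" by (simp add: A_def)
  then show ?thesis using e fe by (intro that[of e l]) auto
qed

text \<open>An orthonormal set of eigenvectors of maximal cardinality spans: its orthogonal
  complement is invariant by self-adjointness, so a nonzero complement would contain one more
  eigenvector.\<close>

lemma selfadjoint_eigenbasis:
  fixes f :: "'n::euclidean_space \<Rightarrow> 'n"
  assumes lin: "linear f" and sa: "\<And>x y. f x \<bullet> y = x \<bullet> f y"
  obtains B l where "finite B" "pairwise orthogonal B" "\<And>b. b \<in> B \<Longrightarrow> norm b = 1" "span B = UNIV"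
    "\<And>b. b \<in> B \<Longrightarrow> f b = l b *\<^sub>R b"
proof -
  define P where "P B \<longleftrightarrow> pairwise orthogonal B \<and> (\<forall>b\<in>B. norm b = 1 \<and> (\<exists>l. f b = l *\<^sub>R b))"
    for B :: "'n set"
  have bd: "finite B \<and> card B \<le> DIM('n)" if "P B" for B
  proof -
    have "independent B" using that unfolding P_def
      by (intro pairwise_orthogonal_independent) auto
    then show ?thesis using independent_bound by blast
  qed
  have "\<exists>B. P B \<and> (\<forall>C. P C \<longrightarrow> card C \<le> card B)"
  proof (rule Lattices_Big.ex_has_greatest_nat[where k="{}" and b="Suc DIM('n)"])
    show "P {}" by (simp add: P_def pairwise_def)
    show "\<forall>C. P C \<longrightarrow> card C < Suc DIM('n)" using bd by (auto simp: less_Suc_eq_le)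
  qed
  then obtain B where B: "P B" and max: "\<And>C. P C \<Longrightarrow> card C \<le> card B" by blast
  have "span B = UNIV"
  proof (rule ccontr)
    assume "span B \<noteq> UNIV"
    then obtain z where z: "z \<noteq> 0" "\<And>x. x \<in> span B \<Longrightarrow> orthogonal z x"
      using span_not_UNIV_orthogonal[of B] by (auto simp: orthogonal_def)
    let ?S = "{x. \<forall>b\<in>B. orthogonal b x}"
    have S: "subspace ?S" by (rule subspace_orthogonal_to_vectors)
    have inv: "f x \<in> ?S" if "x \<in> ?S" for x
    proof clarify
      fix b assume b: "b \<in> B"
      then obtain l where "f b = l *\<^sub>R b" using B by (auto simp: P_def)
      then have "b \<bullet> f x = l * (b \<bullet> x)" using sa[of b x] by simp
      then show "orthogonal b (f x)" using that b by (simp add: orthogonal_def)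
    qed
    have "z \<in> ?S" using z(2) by (auto simp: orthogonal_commute span_base)
    then obtain e l where e: "e \<in> ?S" "norm e = 1" "f e = l *\<^sub>R e"
      using selfadjoint_eigenvector[OF lin sa S inv _ z(1)] by blast
    have "e \<notin> B" using e(1,2) by (auto simp: orthogonal_def)
    moreover have "P (insert e B)"
      using B e unfolding P_def by (auto simp: pairwise_insert orthogonal_commute)
    ultimately show False using max[of "insert e B"] bd[OF B] by simp
  qed
  moreover obtain l where "\<forall>b\<in>B. f b = l b *\<^sub>R b" using B unfolding P_def by metis
  ultimately show ?thesis using B bd[OF B] unfolding P_def by (intro that[of B l]) auto
qed

lemma orthonormal_expansion:
  fixes x :: "'n::euclidean_space"
  assumes B: "finite B" "pairwise orthogonal B" "\<And>b. b \<in> B \<Longrightarrow> norm b = 1" "span B = UNIV"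
  shows "(\<Sum>b\<in>B. (x \<bullet> b) *\<^sub>R b) = x"
  by (rule orthonormal_basis_expand) (use assms in auto)

text \<open>\<open>psd_mat\<close> constrains only the quadratic form, hence only the symmetric part
  of a matrix; symmetry has to be demanded separately.\<close>

definition sym_psd :: "real^'a^'a \<Rightarrow> bool" where
  "sym_psd A \<longleftrightarrow> transpose A = A \<and> psd_mat A"

lemma symmetric_matrix_iff:
  fixes A :: "real^'a^'a"
  shows "transpose A = A \<longleftrightarrow> (\<forall>x y. (A *v x) \<bullet> y = x \<bullet> (A *v y))"
proof -
  have adj: "(A *v x) \<bullet> y = x \<bullet> (transpose A *v y)" for x y
    using dot_lmul_matrix[of y A x] by (simp add: inner_commute)
  show ?thesis
  proof
    assume *: "\<forall>x y. (A *v x) \<bullet> y = x \<bullet> (A *v y)"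
    have "x \<bullet> (transpose A *v y) = x \<bullet> (A *v y)" for x y using * adj[of x y] by simp
    then have "transpose A *v y = A *v y" for y by (metis vector_eq_ldot)
    then show "transpose A = A" by (simp add: matrix_eq)
  qed (simp add: adj del: transpose_matrix_vector)
qed

text \<open>Keep an orthonormal eigenbasis of \<open>q\<close> and replace each eigenvalue by its
  square root.\<close>

lemma sym_psd_sqrt_exists:
  assumes "sym_psd q"
  shows "\<exists>s. sym_psd s \<and> s ** s = q"
proof -
  have sa: "\<And>x y. (q *v x) \<bullet> y = x \<bullet> (q *v y)" and psd: "psd_mat q"
    using assms by (auto simp: sym_psd_def symmetric_matrix_iff)
  obtain B l where B: "finite B" "pairwise orthogonal B" "\<And>b. b \<in> B \<Longrightarrow> norm b = 1" "span B = UNIV"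
    and l: "\<And>b. b \<in> B \<Longrightarrow> q *v b = l b *\<^sub>R b"
    using selfadjoint_eigenbasis[of "(*v) q"] sa by (metis matrix_vector_mul_linear)
  have l0: "0 \<le> l b" if "b \<in> B" for b
  proof -
    have "0 \<le> b \<bullet> (q *v b)" using psd by (simp add: psd_mat_def)
    also have "\<dots> = l b" using l[OF that] B(3)[OF that] by (simp add: dot_square_norm)
    finally show ?thesis .
  qed
  define g where "g x = (\<Sum>b\<in>B. (sqrt (l b) * (x \<bullet> b)) *\<^sub>R b)" for x
  have "linear g"
    by (rule linearI) (simp_all add: g_def inner_add_left algebra_simps sum.distrib
        scaleR_add_left scaleR_sum_right)
  then have s: "matrix g *v x = g x" for x by (simp add: matrix_works)
  have gb: "g b = sqrt (l b) *\<^sub>R b" if b: "b \<in> B" for b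
  proof -
    have "g b = (\<Sum>c\<in>B. if c = b then sqrt (l b) *\<^sub>R b else 0)"
      unfolding g_def
      using B(2,3) b by (intro sum.cong) (auto simp: pairwise_def orthogonal_def dot_square_norm)
    then show ?thesis using B(1) b by simp
  qed
  have gx: "g x \<bullet> y = (\<Sum>b\<in>B. sqrt (l b) * (x \<bullet> b) * (y \<bullet> b))" for x y
    by (simp add: g_def inner_sum_left inner_commute[of y])
  have "transpose (matrix g) = matrix g"
    unfolding symmetric_matrix_iff s by (auto simp: gx inner_commute[of _ "g _"] mult_ac)
  moreover have "v \<bullet> g v = (\<Sum>b\<in>B. sqrt (l b) * (v \<bullet> b)^2)" for v
    using gx[of v v] by (simp add: inner_commute power2_eq_square mult.assoc)
  then have "psd_mat (matrix g)"
    unfolding psd_mat_def s by (auto intro!: sum_nonneg mult_nonneg_nonneg l0)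
  moreover have "g (g x) = q *v x" for x
  proof -
    have "g (g x) = (\<Sum>b\<in>B. (sqrt (l b) * (x \<bullet> b)) *\<^sub>R g b)"
      unfolding g_def[of x] using \<open>linear g\<close> by (simp add: linear_sum linear_scale)
    also have "\<dots> = (\<Sum>b\<in>B. (x \<bullet> b) *\<^sub>R (q *v b))"
      by (intro sum.cong refl) (simp add: gb l l0 mult_ac)
    also have "\<dots> = q *v (\<Sum>b\<in>B. (x \<bullet> b) *\<^sub>R b)"
      by (simp add: linear_sum[OF matrix_vector_mul_linear] matrix_vector_mult_scaleR)
    also have "\<dots> = q *v x" using orthonormal_expansion[OF B] by simp
    finally show ?thesis .
  qed
  then have "matrix g ** matrix g = q"
    by (simp add: matrix_eq matrix_vector_mul_assoc[symmetric] s)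
  ultimately show ?thesis by (auto simp: sym_psd_def)
qed

text \<open>
  Since \<open>2 (s\<^sup>2 - t\<^sup>2) = (s + t) (s - t) + (s - t) (s + t)\<close>, an eigenvector of \<open>s - t\<close> sees
  \<open>s\<^sup>2 - t\<^sup>2\<close> as \<open>l (s + t)\<close>, and \<open>\<bar>s - t\<bar> \<le> s + t\<close> on the diagonal. This yields both the
  uniqueness and the continuity of the square root.
\<close>

lemma sym_psd_diff_eigenvalue:
  assumes "sym_psd s" "sym_psd t" and e: "norm e = 1" "(s - t) *v e = l *\<^sub>R e"
  shows "l^2 \<le> \<bar>e \<bullet> ((s ** s - t ** t) *v e)\<bar>"
proof -
  have st: "\<And>x y. (s *v x) \<bullet> y = x \<bullet> (s *v y)" "\<And>x y. (t *v x) \<bullet> y = x \<bullet> (t *v y)"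
    "0 \<le> e \<bullet> (s *v e)" "0 \<le> e \<bullet> (t *v e)"
    using assms by (auto simp: sym_psd_def symmetric_matrix_iff psd_mat_def)
  have ee: "e \<bullet> e = 1" using e by (simp add: dot_square_norm)
  have se: "s *v e = t *v e + l *\<^sub>R e" using e(2) by (simp add: matrix_vector_mult_diff_rdistrib algebra_simps)
  have l: "l = e \<bullet> (s *v e) - e \<bullet> (t *v e)" by (simp add: se inner_add_right ee)
  have "e \<bullet> ((s ** s - t ** t) *v e) = (s *v e) \<bullet> (s *v e) - (t *v e) \<bullet> (t *v e)"
    by (simp add: matrix_vector_mult_diff_rdistrib inner_diff_right
        matrix_vector_mul_assoc[symmetric] st)
  also have "\<dots> = l * (e \<bullet> (s *v e) + e \<bullet> (t *v e))"
    by (simp add: se inner_add_right inner_add_left ee inner_commute algebra_simps)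
  finally have eq: "\<bar>e \<bullet> ((s ** s - t ** t) *v e)\<bar> = \<bar>l\<bar> * (e \<bullet> (s *v e) + e \<bullet> (t *v e))"
    using st(3,4) by (simp add: abs_mult)
  have "\<bar>l\<bar> \<le> e \<bullet> (s *v e) + e \<bullet> (t *v e)" using l st(3,4) by linarith
  then have "\<bar>l\<bar> * \<bar>l\<bar> \<le> \<bar>l\<bar> * (e \<bullet> (s *v e) + e \<bullet> (t *v e))"
    by (intro mult_left_mono) auto
  then show ?thesis unfolding eq by (simp add: power2_eq_square)
qed

text \<open>The norm of this matrix type is the Frobenius norm, so Cauchy-Schwarz in each row
  suffices.\<close>

lemma norm_matrix_vector_mult_le:
  fixes A :: "real^'n^'m"
  shows "norm (A *v x) \<le> norm A * norm x"
proof -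
  have "(norm (A *v x))^2 = (\<Sum>i\<in>UNIV. ((A $ i) \<bullet> x)^2)"
    unfolding power2_norm_eq_inner inner_vec_def[of "A *v x"]
    by (simp add: matrix_vector_mul_component power2_eq_square)
  also have "\<dots> \<le> (\<Sum>i\<in>UNIV. (norm (A $ i))^2 * (norm x)^2)"
    by (intro sum_mono) (metis Cauchy_Schwarz_ineq2 abs_ge_zero power2_abs power_mono power_mult_distrib)
  also have "\<dots> = (norm A * norm x)^2"
    by (simp add: power_mult_distrib norm_vec_def[of A] L2_set_def sum_nonneg sum_distrib_right)
  finally show ?thesis by (rule power2_le_imp_le) simp
qed

text \<open>Parseval in an orthonormal eigenbasis of the symmetric matrix \<open>s - t\<close>
  reduces the bound to its eigenvalues. Read as a statement about \<open>s ** s\<close> and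
  \<open>t ** t\<close>, this is Hoelder continuity of exponent 1/2, uniform over all positive
  semidefinite matrices.\<close>

lemma sym_psd_diff_bound:
  assumes "sym_psd s" "sym_psd t"
  shows "(norm ((s - t) *v x))^2 \<le> norm (s ** s - t ** t) * (norm x)^2"
proof -
  have sa: "\<And>x y. ((s - t) *v x) \<bullet> y = x \<bullet> ((s - t) *v y)"
    using assms by (auto simp: sym_psd_def symmetric_matrix_iff matrix_vector_mult_diff_rdistrib
        inner_diff_left inner_diff_right)
  obtain B l where B: "finite B" "pairwise orthogonal B" "\<And>b. b \<in> B \<Longrightarrow> norm b = 1" "span B = UNIV"
    and l: "\<And>b. b \<in> B \<Longrightarrow> (s - t) *v b = l b *\<^sub>R b"
    using selfadjoint_eigenbasis[of "(*v) (s - t)"] sa by (metis matrix_vector_mul_linear)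
  have pars: "(norm y)^2 = (\<Sum>b\<in>B. (y \<bullet> b)^2)" for y :: "real^'a"
  proof -
    have "(norm y)^2 = y \<bullet> (\<Sum>b\<in>B. (y \<bullet> b) *\<^sub>R b)"
      using orthonormal_expansion[OF B] by (simp add: power2_norm_eq_inner)
    then show ?thesis by (simp add: inner_sum_right power2_eq_square)
  qed
  have lb: "(l b)^2 \<le> norm (s ** s - t ** t)" if b: "b \<in> B" for b
  proof -
    have "(l b)^2 \<le> \<bar>b \<bullet> ((s ** s - t ** t) *v b)\<bar>"
      by (rule sym_psd_diff_eigenvalue[OF assms B(3)[OF b] l[OF b]])
    also have "\<dots> \<le> norm b * norm ((s ** s - t ** t) *v b)" by (rule Cauchy_Schwarz_ineq2)
    also have "\<dots> \<le> norm b * (norm (s ** s - t ** t) * norm b)"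
      by (intro mult_left_mono norm_matrix_vector_mult_le) auto
    finally show ?thesis using B(3)[OF b] by simp
  qed
  have "(norm ((s - t) *v x))^2 = (\<Sum>b\<in>B. (l b)^2 * (x \<bullet> b)^2)"
    unfolding pars by (intro sum.cong refl) (simp add: sa l power_mult_distrib)
  also have "\<dots> \<le> (\<Sum>b\<in>B. norm (s ** s - t ** t) * (x \<bullet> b)^2)"
    by (intro sum_mono mult_right_mono lb) auto
  also have "\<dots> = norm (s ** s - t ** t) * (norm x)^2" by (simp add: pars sum_distrib_left)
  finally show ?thesis .
qed

lemma psd_sqrt_eqI:
  assumes "sym_psd s" "s ** s = q"
  shows "psd_sqrt q = s"
  unfolding psd_sqrt_def
proof (rule the_equality)
  show "transpose s = s \<and> psd_mat s \<and> s ** s = q" using assms by (simp add: sym_psd_def)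
next
  fix t assume "transpose t = t \<and> psd_mat t \<and> t ** t = q"
  then have "norm ((t - s) *v x) = 0" for x
    using sym_psd_diff_bound[of t s x] assms by (simp add: sym_psd_def)
  then have "(t - s) *v x = 0 *v x" for x by simp
  then have "t - s = 0" by (subst matrix_eq) blast
  then show "t = s" by simp
qed

lemma
  assumes "sym_psd q"
  shows sym_psd_psd_sqrt: "sym_psd (psd_sqrt q)"
    and psd_sqrt_mult_self: "psd_sqrt q ** psd_sqrt q = q"
    and psd_sqrt_mult_transpose: "psd_sqrt q ** transpose (psd_sqrt q) = q"
proof -
  obtain s where s: "sym_psd s" "s ** s = q" using sym_psd_sqrt_exists[OF assms] by blast
  show *: "sym_psd (psd_sqrt q)" "psd_sqrt q ** psd_sqrt q = q"
    unfolding psd_sqrt_eqI[OF s] by (fact s)+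
  then show "psd_sqrt q ** transpose (psd_sqrt q) = q" by (simp add: sym_psd_def)
qed

lemma continuous_on_psd_sqrt: "continuous_on {q. sym_psd q} (psd_sqrt :: real^'a^'a \<Rightarrow> _)"
proof (rule continuous_on_sequentiallyI, clarify)
  fix u :: "nat \<Rightarrow> real^'a^'a" and q
  assume u: "\<forall>n. u n \<in> {q. sym_psd q}" and q: "sym_psd q" and lim: "u \<longlonglongrightarrow> q"
  have col: "(\<lambda>n. (psd_sqrt (u n) - psd_sqrt q) *v x) \<longlonglongrightarrow> 0" for x
  proof (rule Lim_null_comparison)
    show "\<forall>\<^sub>F n in sequentially. norm ((psd_sqrt (u n) - psd_sqrt q) *v x)
        \<le> sqrt (norm (u n - q) * (norm x)^2)"
      using u q sym_psd_diff_bound[of "psd_sqrt (u _)" "psd_sqrt q" x]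
      by (intro always_eventually allI real_le_rsqrt)
         (auto simp: sym_psd_psd_sqrt psd_sqrt_mult_self)
    have "(\<lambda>n. norm (u n - q)) \<longlonglongrightarrow> 0" using lim by (simp add: LIM_zero tendsto_norm_zero)
    then have "(\<lambda>n. sqrt (norm (u n - q) * (norm x)^2)) \<longlonglongrightarrow> sqrt (0 * (norm x)^2)"
      by (intro tendsto_intros)
    then show "(\<lambda>n. sqrt (norm (u n - q) * (norm x)^2)) \<longlonglongrightarrow> 0" by simp
  qed
  show "(\<lambda>n. psd_sqrt (u n)) \<longlonglongrightarrow> psd_sqrt q"
  proof (intro vec_tendstoI)
    fix i j
    have "(\<lambda>n. ((psd_sqrt (u n) - psd_sqrt q) *v axis j 1) $ i) \<longlonglongrightarrow> 0 $ i"
      by (intro tendsto_vec_nth col)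
    then have "(\<lambda>n. psd_sqrt (u n) $ i $ j - psd_sqrt q $ i $ j) \<longlonglongrightarrow> 0"
      by (simp add: matrix_vector_mul_component inner_axis)
    then show "(\<lambda>n. psd_sqrt (u n) $ i $ j) \<longlonglongrightarrow> psd_sqrt q $ i $ j"
      by (rule LIM_zero_cancel)
  qed
qed

section \<open>Uniqueness of multivariate characteristic functions\<close>

text \<open>Normalising \<open>h\<close> turns both sides into probability laws of \<open>X\<close>
  with equal characteristic functions, so one-dimensional Levy uniqueness applies. Their common
  total mass is read off at \<open>s = 0\<close>; if it is zero, nothing can be normalised, but then
  \<open>h\<close> vanishes almost everywhere. The weight carries the information on the other
  coordinates along.\<close>

lemma weighted_law_unique:
  fixes M N :: "'a measure" and h :: "'a \<Rightarrow> real" and X :: "'a \<Rightarrow> real"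
  assumes M: "prob_space M" and N: "prob_space N"
    and hM[measurable]: "h \<in> borel_measurable M" and hN[measurable]: "h \<in> borel_measurable N"
    and XM[measurable]: "X \<in> borel_measurable M" and XN[measurable]: "X \<in> borel_measurable N"
    and h0: "\<And>x. 0 \<le> h x" and hB: "\<And>x. h x \<le> B"
    and eq: "\<And>s. (CLINT x|M. h x *\<^sub>R iexp (s * X x)) = (CLINT x|N. h x *\<^sub>R iexp (s * X x))"
    and A[measurable]: "A \<in> sets borel"
  shows "(LINT x|M. h x * indicat_real A (X x)) = (LINT x|N. h x * indicat_real A (X x))"
proof -
  interpret M: prob_space M by fact
  interpret N: prob_space N by fact
  have hB': "norm (h x) \<le> B" for x using h0[of x] hB[of x] by simp
  have intM: "integrable M h" by (rule M.integrable_const_bound[of _ B]) (use hB' in auto)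
  have intN: "integrable N h" by (rule N.integrable_const_bound[of _ B]) (use hB' in auto)
  define m where "m = integral\<^sup>L M h"
  have mN: "m = integral\<^sup>L N h"
    using eq[of 0] intM intN by (simp add: m_def scaleR_conv_of_real)
  have m0: "0 \<le> m" unfolding m_def by (rule integral_nonneg_AE) (use h0 in auto)
  show ?thesis
  proof (cases "m = 0")
    case True
    have "AE x in M. h x = 0" using intM True h0 unfolding m_def
      by (subst (asm) integral_nonneg_eq_0_iff_AE) auto
    moreover have "AE x in N. h x = 0" using intN True h0 unfolding mN
      by (subst (asm) integral_nonneg_eq_0_iff_AE) auto
    ultimately show ?thesis
      by (subst (1 2) integral_cong_AE[where g="\<lambda>_. 0"]) auto
  next
    case False
    then have m: "m > 0" using m0 by simp
    define law where "law P = distr (density P (\<lambda>x. ennreal (h x / m))) borel X" for P :: "'a measure"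
    have law: "real_distribution (law P) \<and>
        (\<forall>s. char (law P) s = (CLINT x|P. h x *\<^sub>R iexp (s * X x)) / m) \<and>
        measure (law P) A = (LINT x|P. h x * indicat_real A (X x)) / m"
      if P: "prob_space P" and [measurable]: "h \<in> borel_measurable P" "X \<in> borel_measurable P"
        and int: "integrable P h" "integral\<^sup>L P h = m" for P
    proof (intro conjI allI)
      interpret P: prob_space P by fact
      have "emeasure (density P (\<lambda>x. ennreal (h x / m))) (space (density P (\<lambda>x. ennreal (h x / m)))) = 1"
        using int m h0 by (subst emeasure_density) (auto simp: nn_integral_eq_integral cong: nn_integral_cong)
      then interpret D: prob_space "density P (\<lambda>x. ennreal (h x / m))" by (rule prob_spaceI)
      show rd: "real_distribution (law P)" unfolding law_def
        by (intro real_distribution.intro real_distribution_axioms.intro D.prob_space_distr) auto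
      show "char (law P) s = (CLINT x|P. h x *\<^sub>R iexp (s * X x)) / m" for s
      proof -
        have "char (law P) s = (CLINT x|P. (h x / m) *\<^sub>R iexp (s * X x))"
          unfolding char_def law_def using h0 m
          by (simp add: integral_distr integral_density)
        also have "\<dots> = (CLINT x|P. (h x *\<^sub>R iexp (s * X x)) / m)"
          by (intro Bochner_Integration.integral_cong refl) (simp add: scaleR_conv_of_real)
        finally show ?thesis by simp
      qed
      have "measure (law P) A = (LINT x|law P. indicat_real A x)"
        using rd by (simp add: law_def)
      also have "\<dots> = (LINT x|P. (h x / m) *\<^sub>R indicat_real A (X x))"
        unfolding law_def using h0 m by (subst integral_distr, simp, simp, subst integral_density) auto
      finally show "measure (law P) A = (LINT x|P. h x * indicat_real A (X x)) / m" by simp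
    qed
    note lM = law[OF M hM XM intM m_def[symmetric]] and lN = law[OF N hN XN intN mN[symmetric]]
    have "law M = law N"
      using lM lN eq by (intro Levy_uniqueness) (auto simp: fun_eq_iff)
    then show ?thesis using lM lN m by simp
  qed
qed

text \<open>A nonnegative weight times a character is a combination of characters, so integrals
  against it are determined by the characteristic function.\<close>

lemma one_plus_trig_scaleR_iexp:
  "(1 + cos u) *\<^sub>R iexp v = iexp v + (iexp (v + u) + iexp (v - u)) / 2"
  "(1 + sin u) *\<^sub>R iexp v = iexp v + (iexp (v + u) - iexp (v - u)) / (2 * \<i>)"
  unfolding cis_conv_exp[symmetric]
  by (auto simp: complex_eq_iff cos_add sin_add cos_diff sin_diff
      field_simps Re_divide Im_divide power2_eq_square)

text \<open>Coordinates are converted one at a time from characters to indicators; since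
  one-dimensional uniqueness needs positive weights, the character in the remaining
  coordinates is recovered from the weights \<open>1 + cos\<close> and \<open>1 + sin\<close>.\<close>

lemma characteristic_function_unique_aux:
  fixes M N :: "(real^'i::finite) measure"
  assumes M: "prob_space M" "sets M = sets borel" and N: "prob_space N" "sets N = sets borel"
    and eq: "\<And>t. (CLINT x|M. iexp (t \<bullet> x)) = (CLINT x|N. iexp (t \<bullet> x))"
    and A: "\<And>c. A c \<in> sets borel" and F: "finite F" and t: "\<And>c. c \<in> F \<Longrightarrow> t $ c = 0"
  shows "(CLINT x|M. (\<Prod>c\<in>F. indicat_real (A c) (x $ c)) *\<^sub>R iexp (t \<bullet> x)) =
         (CLINT x|N. (\<Prod>c\<in>F. indicat_real (A c) (x $ c)) *\<^sub>R iexp (t \<bullet> x))"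
  using F t
proof (induction F arbitrary: t)
  case empty
  then show ?case using eq by simp
next
  case (insert c F)
  note [measurable] = A
  note [measurable_cong] = M(2) N(2)
  interpret M: prob_space M by fact
  interpret N: prob_space N by fact
  define W where "W x = (\<Prod>c\<in>F. indicat_real (A c) (x $ c))" for x :: "real^'i"
  have W[measurable]: "W \<in> borel_measurable borel" unfolding W_def by measurable
  have W01: "0 \<le> W x" "W x \<le> 1" for x
    unfolding W_def by (auto intro!: prod_nonneg prod_le_1 simp: indicator_def)
  have IH: "(CLINT x|M. W x *\<^sub>R iexp (u \<bullet> x)) = (CLINT x|N. W x *\<^sub>R iexp (u \<bullet> x))"
    if "\<And>c. c \<in> F \<Longrightarrow> u $ c = 0" for u
    using insert.IH[OF that] by (simp add: W_def)
  have int: "integrable P (\<lambda>x. (W x * g x) *\<^sub>R iexp (u \<bullet> x))"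
    if "P = M \<or> P = N" "g \<in> borel_measurable borel" "\<And>x. \<bar>g x\<bar> \<le> 1" for P u and g :: "real^'i \<Rightarrow> real"
  proof -
    interpret P: prob_space P using that M N by auto
    have [measurable_cong]: "sets P = sets borel" using that M N by auto
    note [measurable] = that(2)
    have "\<bar>W x * g x\<bar> \<le> 1" for x
      using W01[of x] that(3)[of x] by (simp add: abs_mult mult_le_one)
    then show ?thesis by (intro P.integrable_const_bound[of _ 1]) auto
  qed
  have int1: "integrable P (\<lambda>x. W x *\<^sub>R iexp (u \<bullet> x))" if "P = M \<or> P = N" for P u
    using int[OF that, of "\<lambda>_. 1" u] by simp
  have tz: "t $ c = 0" "\<And>d. d \<in> F \<Longrightarrow> t $ d = 0" using insert.prems by auto
  have ax: "axis c s \<bullet> x = s * x $ c" for s and x :: "real^'i" by (simp add: inner_axis')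
  \<comment> \<open>The induction hypothesis admits only characters that ignore the coordinates in
    \<open>F\<close>. As \<open>c\<close> is not in \<open>F\<close>, shifting along
    \<open>axis c\<close> preserves this.\<close>
  have zero: "(axis c s + t) $ d = 0 \<and> (axis c s - t) $ d = 0 \<and> axis c s $ d = 0" if "d \<in> F" for d s
    using insert.hyps that tz by (auto simp: axis_def)
  \<comment> \<open>One-dimensional uniqueness for the coordinate \<open>c\<close>, with the
    indicators already obtained and one of the three trigonometric weights together as the
    weight.\<close>
  have wt: "(LINT x|M. W x * g (t \<bullet> x) * indicat_real (A c) (x $ c)) =
            (LINT x|N. W x * g (t \<bullet> x) * indicat_real (A c) (x $ c))"
    if g: "g = (\<lambda>u. 1 + cos u) \<or> g = (\<lambda>u. 1 + sin u) \<or> g = (\<lambda>u. 1)" for g :: "real \<Rightarrow> real"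
  proof (rule weighted_law_unique[OF M(1) N(1), where B=2])
    have [measurable]: "g \<in> borel_measurable borel" using g by auto
    show "(\<lambda>x. W x * g (t \<bullet> x)) \<in> borel_measurable M" "(\<lambda>x. W x * g (t \<bullet> x)) \<in> borel_measurable N"
      "(\<lambda>x. x $ c) \<in> borel_measurable M" "(\<lambda>x. x $ c) \<in> borel_measurable N" by measurable
    have g02: "0 \<le> g u" "g u \<le> 2" for u
      using g by (auto simp: add_nonneg_nonneg intro: order_trans[OF add_left_mono[OF cos_le_one]]
        order_trans[OF add_left_mono[OF sin_le_one]]) (smt (verit) cos_ge_minus_one sin_ge_minus_one)+
    show "0 \<le> W x * g (t \<bullet> x)" for x using W01 g02 by simp
    show "W x * g (t \<bullet> x) \<le> 2" for x
      using mult_mono[of "W x" 1 "g (t \<bullet> x)" 2] W01 g02 by simp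
    show "A c \<in> sets borel" by (rule A)
    fix s
    let ?e = "\<lambda>u x. W x *\<^sub>R iexp (u \<bullet> x)"
    have I: "(CLINT x|M. ?e (axis c s) x) = (CLINT x|N. ?e (axis c s) x)"
      "(CLINT x|M. ?e (axis c s + t) x) = (CLINT x|N. ?e (axis c s + t) x)"
      "(CLINT x|M. ?e (axis c s - t) x) = (CLINT x|N. ?e (axis c s - t) x)"
      by (rule IH; use zero in blast)+
    have 1: "(W x * g (t \<bullet> x)) *\<^sub>R iexp (s * x $ c) = W x *\<^sub>R (g (t \<bullet> x) *\<^sub>R iexp (axis c s \<bullet> x))" for x
      by (simp add: ax)
    from g consider "g = (\<lambda>u. 1 + cos u)" | "g = (\<lambda>u. 1 + sin u)" | "g = (\<lambda>u. 1)" by blast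
    then show "(CLINT x|M. (W x * g (t \<bullet> x)) *\<^sub>R iexp (s * x $ c)) =
               (CLINT x|N. (W x * g (t \<bullet> x)) *\<^sub>R iexp (s * x $ c))"
    proof cases
      case 1
      have "(W x * g (t \<bullet> x)) *\<^sub>R iexp (s * x $ c) =
          ?e (axis c s) x + (?e (axis c s + t) x + ?e (axis c s - t) x) / 2" for x
        unfolding 1 scaleR_scaleR[symmetric] one_plus_trig_scaleR_iexp ax[symmetric]
        by (simp add: inner_add_left inner_diff_left scaleR_conv_of_real algebra_simps)
      then show ?thesis by (simp add: int1 I)
    next
      case 2
      have "(W x * g (t \<bullet> x)) *\<^sub>R iexp (s * x $ c) =
          ?e (axis c s) x + (?e (axis c s + t) x - ?e (axis c s - t) x) / (2 * \<i>)" for x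
        unfolding 2 scaleR_scaleR[symmetric] one_plus_trig_scaleR_iexp ax[symmetric]
        by (simp add: inner_add_left inner_diff_left scaleR_conv_of_real algebra_simps diff_divide_distrib)
      then show ?thesis by (simp add: int1 I)
    next
      case 3
      then show ?thesis using I(1) by (simp add: ax)
    qed
  qed
  let ?V = "\<lambda>x. W x * indicat_real (A c) (x $ c)"
  have intr: "integrable P (\<lambda>x. ?V x * g (t \<bullet> x))"
    if P: "P = M \<or> P = N" and g: "g = cos \<or> g = sin \<or> g = (\<lambda>_. 1)" for P and g :: "real \<Rightarrow> real"
  proof -
    have [measurable]: "g \<in> borel_measurable borel" using g by auto
    have "\<bar>g u\<bar> \<le> 1" for u using g by auto
    then have "integrable P (\<lambda>x. (W x * (indicat_real (A c) (x $ c) * g (t \<bullet> x))) *\<^sub>R iexp (0 \<bullet> x))"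
      using P by (intro int) (auto simp: indicator_def)
    then have "integrable P (\<lambda>x. complex_of_real (?V x * g (t \<bullet> x)))"
      by (simp add: scaleR_conv_of_real mult_ac)
    then show ?thesis by (simp only: complex_of_real_integrable_eq)
  qed
  have c0: "(LINT x|M. ?V x) = (LINT x|N. ?V x)" using wt[of "\<lambda>_. 1"] by simp
  \<comment> \<open>Subtracting the case of weight 1 removes the constant that was added to make the
    weight nonnegative.\<close>
  have cs: "(LINT x|M. ?V x * g (t \<bullet> x)) = (LINT x|N. ?V x * g (t \<bullet> x))"
    if g: "g = cos \<or> g = sin" for g :: "real \<Rightarrow> real"
  proof -
    have "(LINT x|M. ?V x + ?V x * g (t \<bullet> x)) = (LINT x|N. ?V x + ?V x * g (t \<bullet> x))"
      using wt[of "\<lambda>u. 1 + g u"] g by (auto simp: algebra_simps)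
    then show ?thesis
      using c0 intr[of M g] intr[of N g] intr[of M "\<lambda>_. 1"] intr[of N "\<lambda>_. 1"] g by auto
  qed
  have split: "(\<Prod>c\<in>insert c F. indicat_real (A c) (x $ c)) *\<^sub>R iexp (t \<bullet> x) =
      complex_of_real (?V x * cos (t \<bullet> x)) + \<i> * complex_of_real (?V x * sin (t \<bullet> x))" for x
  proof -
    have "(\<Prod>c\<in>insert c F. indicat_real (A c) (x $ c)) = ?V x"
      using insert.hyps by (simp add: W_def mult.commute)
    then show ?thesis
      unfolding cis_conv_exp[symmetric] by (simp only: complex_eq_iff) simp
  qed
  have "(CLINT x|P. (\<Prod>c\<in>insert c F. indicat_real (A c) (x $ c)) *\<^sub>R iexp (t \<bullet> x)) =
     complex_of_real (LINT x|P. ?V x * cos (t \<bullet> x)) + \<i> * complex_of_real (LINT x|P. ?V x * sin (t \<bullet> x))"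
    if "P = M \<or> P = N" for P
    unfolding split using intr[OF that, of cos] intr[OF that, of sin]
    by (subst Bochner_Integration.integral_add) (auto simp del: of_real_mult)
  then show ?case using cs by simp
qed

text \<open>Once all coordinates are converted and \<open>t = 0\<close>, the integrals are the
  measures of boxes, and boxes form an intersection-stable generator of the Borel sets.\<close>

theorem characteristic_function_unique:
  fixes M N :: "(real^'i::finite) measure"
  assumes M: "prob_space M" "sets M = sets borel" and N: "prob_space N" "sets N = sets borel"
    and eq: "\<And>t. (CLINT x|M. iexp (t \<bullet> x)) = (CLINT x|N. iexp (t \<bullet> x))"
  shows "M = N"
proof -
  interpret M: prob_space M by fact
  interpret N: prob_space N by fact
  have bx: "measure M (box a b) = measure N (box a b)" for a b :: "real^'i"
  proof -
    have ind: "(\<Prod>c\<in>UNIV. indicat_real {a$c<..<b$c} (x $ c)) = indicat_real (box a b) x" for x :: "real^'i"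
      by (auto simp: indicator_def mem_box_cart prod_eq_1_iff)
    have m: "(CLINT x|P. (\<Prod>c\<in>UNIV. indicat_real {a$c<..<b$c} (x $ c)) *\<^sub>R iexp (0 \<bullet> x))
        = complex_of_real (measure P (box a b))" if "sets P = sets borel" "prob_space P" for P
    proof -
      interpret P: prob_space P by fact
      have "box a b \<in> sets P" "box a b \<inter> space P = box a b" using that sets_eq_imp_space_eq[of P borel] by auto
      then show ?thesis unfolding ind by (simp add: scaleR_conv_of_real)
    qed
    have "complex_of_real (measure M (box a b)) = complex_of_real (measure N (box a b))"
      using characteristic_function_unique_aux[OF M N eq, of "\<lambda>c. {a$c<..<b$c}" UNIV 0] m M N by simp
    then show ?thesis by simp
  qed
  show ?thesis
  proof (rule measure_eqI_generator_eq)
    let ?E = "range (\<lambda>(a, b). box a b::(real^'i) set)"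
    show "Int_stable ?E"
      by (auto simp: Int_stable_def box_Int_box)
    show "?E \<subseteq> Pow UNIV" "sets M = sigma_sets UNIV ?E" "sets N = sigma_sets UNIV ?E"
      by (simp_all add: borel_eq_box M N)
    let ?A = "\<lambda>n::nat. box (- (real n *\<^sub>R One)) (real n *\<^sub>R One) :: (real^'i) set"
    show "range ?A \<subseteq> ?E" "(\<Union>i. ?A i) = UNIV"
      unfolding UN_box_eq_UNIV by auto
    show "emeasure M (?A i) \<noteq> \<infinity>" for i by simp
    show "emeasure M X = emeasure N X" if "X \<in> ?E" for X
      using that bx by (auto simp: M.emeasure_eq_measure N.emeasure_eq_measure)
  qed
qed

section \<open>Gaussian vectors\<close>

lemma borel_measurable_vec_lambda:
  fixes f :: "'w \<Rightarrow> 'i::finite \<Rightarrow> real"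
  assumes "\<And>c. (\<lambda>\<omega>. f \<omega> c) \<in> borel_measurable M"
  shows "(\<lambda>\<omega>. \<chi> c. f \<omega> c) \<in> borel_measurable M"
  using assms by (subst borel_measurable_euclidean_space) (auto simp: Basis_vec_def inner_axis)

text \<open>The density is the one written out in \<open>y_mat\<close>. The index type is arbitrary
  because the measure is needed both for \<open>'a\<close> and for
  \<open>'a \<times> 'k\<close>.\<close>

definition std_gauss :: "(real^'i::finite) measure" where
  "std_gauss = density lborel (\<lambda>x. ennreal (\<Prod>c\<in>UNIV. std_normal_density (x $ c)))"

lemma sets_std_gauss[simp, measurable_cong]: "sets std_gauss = sets borel"
  and space_std_gauss[simp]: "space std_gauss = UNIV"
  by (simp_all add: std_gauss_def)

lemma nn_integral_lborel_vec_prod: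
  fixes f :: "'i::finite \<Rightarrow> real \<Rightarrow> ennreal"
  assumes [measurable]: "\<And>c. f c \<in> borel_measurable borel"
  shows "(\<integral>\<^sup>+x. (\<Prod>c\<in>UNIV. f c (x $ c)) \<partial>(lborel :: (real^'i) measure)) = (\<Prod>c\<in>UNIV. \<integral>\<^sup>+u. f c u \<partial>lborel)"
proof -
  have B: "(Basis :: (real^'i) set) = range (\<lambda>c. axis c 1)" by (auto simp: Basis_vec_def)
  have inj: "inj (\<lambda>c::'i. axis c (1::real))" by (auto simp: inj_on_def axis_eq_axis)
  let ?f = "\<lambda>b::real^'i. f (axis_index b)"
  have ai: "axis_index (axis c (1::real)) = c" for c :: 'i
    unfolding axis_index_def by (rule some_equality) (auto simp: axis_eq_axis)
  have "(\<integral>\<^sup>+x. (\<Prod>b\<in>Basis. ?f b (x \<bullet> b)) \<partial>(lborel :: (real^'i) measure)) = (\<Prod>b\<in>Basis. \<integral>\<^sup>+u. ?f b u \<partial>lborel)"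
    by (intro nn_integral_lborel_prod) auto
  then show ?thesis unfolding B by (simp add: prod.reindex[OF inj] ai inner_axis)
qed

lemma nn_integral_std_gauss_prod:
  fixes f :: "'i::finite \<Rightarrow> real \<Rightarrow> ennreal"
  assumes [measurable]: "\<And>c. f c \<in> borel_measurable borel"
  shows "(\<integral>\<^sup>+x. (\<Prod>c\<in>UNIV. f c (x $ c)) \<partial>(std_gauss :: (real^'i) measure)) =
         (\<Prod>c\<in>UNIV. \<integral>\<^sup>+u. f c u \<partial>std_normal_distribution)"
proof -
  have "(\<integral>\<^sup>+x. (\<Prod>c\<in>UNIV. f c (x $ c)) \<partial>(std_gauss :: (real^'i) measure)) =
     (\<integral>\<^sup>+x. (\<Prod>c\<in>UNIV. ennreal (std_normal_density (x $ c)) * f c (x $ c)) \<partial>(lborel :: (real^'i) measure))"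
    unfolding std_gauss_def
    by (subst nn_integral_density) (auto simp: prod.distrib prod_ennreal)
  also have "\<dots> = (\<Prod>c\<in>UNIV. \<integral>\<^sup>+u. ennreal (std_normal_density u) * f c u \<partial>lborel)"
    by (rule nn_integral_lborel_vec_prod) simp
  finally show ?thesis by (simp add: nn_integral_density)
qed

interpretation std_normal: real_distribution std_normal_distribution
  by (rule real_dist_normal_dist)

lemma prob_space_std_gauss: "prob_space (std_gauss :: (real^'i::finite) measure)"
proof (rule prob_spaceI)
  show "emeasure (std_gauss :: (real^'i) measure) (space std_gauss) = 1"
    using nn_integral_std_gauss_prod[of "\<lambda>(_::'i) _. 1"] std_normal.emeasure_space_1 by simp
qed

lemma emeasure_std_gauss_box:
  fixes A :: "'i::finite \<Rightarrow> real set"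
  assumes [measurable]: "\<And>c. A c \<in> sets borel"
  shows "emeasure std_gauss {x. \<forall>c. x $ c \<in> A c} = (\<Prod>c\<in>UNIV. emeasure std_normal_distribution (A c))"
proof -
  have [measurable]: "{x :: real^'i. \<forall>c. x $ c \<in> A c} \<in> sets borel" by measurable
  have "emeasure std_gauss {x. \<forall>c. x $ c \<in> A c} = (\<integral>\<^sup>+x. (\<Prod>c\<in>UNIV. indicator (A c) (x $ c)) \<partial>std_gauss)"
    by (subst nn_integral_indicator[symmetric], simp, intro nn_integral_cong)
       (auto simp: indicator_def prod_eq_1_iff)
  also have "\<dots> = (\<Prod>c\<in>UNIV. \<integral>\<^sup>+u. indicator (A c) u \<partial>std_normal_distribution)"
    by (rule nn_integral_std_gauss_prod) simp
  finally show ?thesis by simp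
qed

lemma distr_std_gauss_component:
  "distr (std_gauss :: (real^'i::finite) measure) borel (\<lambda>x. x $ c) = std_normal_distribution"
proof (rule measure_eqI)
  fix A assume "A \<in> sets (distr (std_gauss :: (real^'i) measure) borel (\<lambda>x. x $ c))"
  then have [measurable]: "A \<in> sets borel" by simp
  have "emeasure (distr std_gauss borel (\<lambda>x. x $ c)) A = emeasure std_gauss {x :: real^'i. \<forall>d. x $ d \<in> (if d = c then A else UNIV)}"
    by (subst emeasure_distr) (auto intro!: arg_cong2[where f=emeasure] split: if_splits)
  also have "\<dots> = (\<Prod>d\<in>(UNIV::'i set). emeasure std_normal_distribution (if d = c then A else UNIV))"
    by (rule emeasure_std_gauss_box) simp
  also have "\<dots> = (\<Prod>d\<in>(UNIV::'i set). if d = c then emeasure std_normal_distribution A else 1)"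
    using std_normal.emeasure_space_1 by (intro prod.cong) auto
  finally show "emeasure (distr (std_gauss :: (real^'i) measure) borel (\<lambda>x. x $ c)) A
      = emeasure std_normal_distribution A" by simp
qed simp

text \<open>Makes the coordinates of the reference vector an instance of the independent normal
  families treated below.\<close>

lemma indep_vars_std_gauss:
  "prob_space.indep_vars (std_gauss :: (real^'i::finite) measure) (\<lambda>_. borel) (\<lambda>c x. x $ c) UNIV"
proof -
  interpret prob_space "std_gauss :: (real^'i) measure" by (rule prob_space_std_gauss)
  interpret P: product_sigma_finite "\<lambda>_::'i. std_normal_distribution"
    by standard
  have "distr (std_gauss :: (real^'i) measure) (\<Pi>\<^sub>M i\<in>UNIV. borel) (\<lambda>x. \<lambda>i\<in>UNIV. x $ i)
      = (\<Pi>\<^sub>M i\<in>UNIV. std_normal_distribution)"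
  proof (rule P.PiM_eqI)
    fix A :: "'i \<Rightarrow> real set" assume "\<And>i. i \<in> UNIV \<Longrightarrow> A i \<in> sets std_normal_distribution"
    then have [measurable]: "A i \<in> sets borel" for i by simp
    have "emeasure (distr (std_gauss :: (real^'i) measure) (\<Pi>\<^sub>M i\<in>UNIV. borel) (\<lambda>x. \<lambda>i\<in>UNIV. x $ i)) (Pi\<^sub>E UNIV A)
       = emeasure std_gauss {x :: real^'i. \<forall>c. x $ c \<in> A c}"
      by (subst emeasure_distr) (auto intro!: arg_cong2[where f=emeasure] sets_PiM_I_finite)
    then show "emeasure (distr (std_gauss :: (real^'i) measure) (\<Pi>\<^sub>M i\<in>UNIV. borel) (\<lambda>x. \<lambda>i\<in>UNIV. x $ i)) (Pi\<^sub>E UNIV A)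
       = (\<Prod>i\<in>UNIV. emeasure std_normal_distribution (A i))"
      by (simp add: emeasure_std_gauss_box)
  qed (auto intro!: sets_PiM_cong)
  then show ?thesis
    by (subst indep_vars_iff_distr_eq_PiM') (auto simp: distr_std_gauss_component)
qed

lemma centered_normal_1: "centered_normal 1 = std_normal_distribution"
  by (simp add: centered_normal_def)

text \<open>The Dirac branch and the density branch of \<open>centered_normal\<close> obey the same
  formula, so degenerate biases (\<open>Cb = 0\<close>) are handled together with the others from
  here on.\<close>

lemma char_centered_normal:
  assumes "v \<ge> 0"
  shows "char (centered_normal v) t = complex_of_real (exp (- (v * t^2) / 2))"
proof (cases "v = 0")
  case True
  have "(CLINT x|return borel (0::real). iexp (t * x)) = iexp (t * 0)"
    by (rule integral_return) auto
  then show ?thesis using True by (simp add: centered_normal_def char_def)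
next
  case False
  then have v: "sqrt v > 0" using assms by simp
  have "distributed std_normal_distribution lborel (\<lambda>x. x) std_normal_density"
    by (auto simp: distributed_def distr_id2 intro: distr_cong)
  from std_normal.normal_density_affine[OF this, of "sqrt v" 0] v
  have d: "distr std_normal_distribution lborel (\<lambda>x. sqrt v * x) = density lborel (normal_density 0 (sqrt v))"
    by (simp add: distributed_def)
  have "char (centered_normal v) t = (CLINT x|distr std_normal_distribution lborel (\<lambda>x. sqrt v * x). iexp (t * x))"
    unfolding d using False by (simp add: centered_normal_def char_def)
  also have "\<dots> = char std_normal_distribution (t * sqrt v)"
    by (subst integral_distr) (auto simp: char_def mult_ac)
  also have "\<dots> = complex_of_real (exp (- (v * t^2) / 2))"
    using assms by (simp add: char_std_normal_distribution power_mult_distrib mult.commute)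
  finally show ?thesis .
qed

text \<open>Pairing with \<open>t\<close> leaves one scalar combination of independent normals, with
  coefficients \<open>c j\<close>. The exponent is regrouped so that \<open>u\<close> and
  \<open>v\<close> enter only through the covariance matrix.\<close>

lemma (in prob_space) characteristic_function_normal_sum:
  fixes u :: "'i::finite \<Rightarrow> 'j \<Rightarrow> real"
  assumes J: "finite J" and ind: "indep_vars (\<lambda>_. borel) X J"
    and d: "\<And>j. j \<in> J \<Longrightarrow> distr M borel (X j) = centered_normal (v j)" and v: "\<And>j. j \<in> J \<Longrightarrow> 0 \<le> v j"
  shows "(CLINT \<omega>|M. iexp (t \<bullet> (\<chi> p. \<Sum>j\<in>J. u p j * X j \<omega>))) =
    complex_of_real (exp (- (\<Sum>p\<in>UNIV. \<Sum>p'\<in>UNIV. t $ p * t $ p' * (\<Sum>j\<in>J. v j * u p j * u p' j)) / 2))"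
proof -
  have rv[measurable]: "X j \<in> borel_measurable M" if "j \<in> J" for j using ind that by (auto simp: indep_vars_def)
  define c where "c j = (\<Sum>p\<in>UNIV. t $ p * u p j)" for j
  have tV: "t \<bullet> (\<chi> p. \<Sum>j\<in>J. u p j * X j \<omega>) = (\<Sum>j\<in>J. c j * X j \<omega>)" for \<omega>
    unfolding c_def inner_vec_def sum_distrib_right
    by (subst sum.swap) (simp add: sum_distrib_left mult_ac)
  have "(CLINT \<omega>|M. iexp (t \<bullet> (\<chi> p. \<Sum>j\<in>J. u p j * X j \<omega>))) = char (distr M borel (\<lambda>\<omega>. \<Sum>j\<in>J. c j * X j \<omega>)) 1"
    unfolding tV char_def by (subst integral_distr) auto
  also have "\<dots> = (\<Prod>j\<in>J. char (distr M borel (\<lambda>\<omega>. c j * X j \<omega>)) 1)"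
    by (intro char_distr_sum indep_vars_compose2[OF ind]) auto
  also have "\<dots> = (\<Prod>j\<in>J. complex_of_real (exp (- (v j * (c j)^2) / 2)))"
  proof (intro prod.cong refl)
    fix j assume j: "j \<in> J"
    have "char (distr M borel (\<lambda>\<omega>. c j * X j \<omega>)) 1 = char (distr M borel (X j)) (c j)"
      unfolding char_def using j by (simp add: integral_distr)
    then show "char (distr M borel (\<lambda>\<omega>. c j * X j \<omega>)) 1 = complex_of_real (exp (- (v j * (c j)^2) / 2))"
      using d[OF j] v[OF j] by (simp add: char_centered_normal)
  qed
  also have "\<dots> = complex_of_real (exp (\<Sum>j\<in>J. - (v j * (c j)^2) / 2))"
    using J by (simp add: exp_sum)
  also have "(\<Sum>j\<in>J. - (v j * (c j)^2) / 2) = - (\<Sum>j\<in>J. v j * (c j)^2) / 2"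
    by (simp add: sum_negf sum_divide_distrib)
  also have "(\<Sum>j\<in>J. v j * (c j)^2) = (\<Sum>j\<in>J. \<Sum>p\<in>UNIV. \<Sum>p'\<in>UNIV. t $ p * t $ p' * (v j * u p j * u p' j))"
    unfolding c_def power2_eq_square sum_product
    unfolding sum_distrib_left by (intro sum.cong refl) (simp add: mult_ac)
  also have "\<dots> = (\<Sum>p\<in>UNIV. \<Sum>p'\<in>UNIV. t $ p * t $ p' * (\<Sum>j\<in>J. v j * u p j * u p' j))"
    unfolding sum_distrib_left by (subst sum.swap, intro sum.cong refl, subst sum.swap) simp
  finally show ?thesis .
qed

text \<open>Both sides are linear images of independent normals, with coefficients \<open>u\<close>
  and \<open>T\<close> respectively, and their characteristic functions depend on the covariance
  alone. Any factor \<open>T\<close> of the covariance is allowed, invertible or not.\<close>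

theorem (in prob_space) distr_normal_sum_eq_std_gauss:
  fixes u :: "'i::finite \<Rightarrow> 'j \<Rightarrow> real" and T :: "real^'i^'i"
  assumes J: "finite J" and ind: "indep_vars (\<lambda>_. borel) X J"
    and d: "\<And>j. j \<in> J \<Longrightarrow> distr M borel (X j) = centered_normal (v j)" and v: "\<And>j. j \<in> J \<Longrightarrow> 0 \<le> v j"
    and cov: "\<And>p p'. (\<Sum>j\<in>J. v j * u p j * u p' j) = (T ** transpose T) $ p $ p'"
  shows "distr M borel (\<lambda>\<omega>. \<chi> p. \<Sum>j\<in>J. u p j * X j \<omega>) = distr std_gauss borel (\<lambda>r. T *v r)"
proof -
  have [measurable]: "X j \<in> borel_measurable M" if "j \<in> J" for j using ind that by (auto simp: indep_vars_def)
  have V[measurable]: "(\<lambda>\<omega>. \<chi> p. \<Sum>j\<in>J. u p j * X j \<omega>) \<in> borel_measurable M"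
    by (rule borel_measurable_vec_lambda) measurable
  have T[measurable]: "(\<lambda>r. T *v r) \<in> borel_measurable (std_gauss :: (real^'i) measure)"
    by (intro borel_measurable_continuous_onI[THEN measurable_cong_sets[THEN equalityD1, THEN subsetD, rotated 2]])
       (auto intro: linear_continuous_on)
  interpret G: prob_space "std_gauss :: (real^'i) measure" by (rule prob_space_std_gauss)
  show ?thesis
  proof (rule characteristic_function_unique)
    fix t :: "real^'i"
    have "(CLINT x|distr std_gauss borel (\<lambda>r. T *v r). iexp (t \<bullet> x)) =
      (CLINT r|std_gauss. iexp (t \<bullet> (\<chi> p. \<Sum>j\<in>UNIV. T $ p $ j * r $ j)))"
      by (subst integral_distr) (auto simp: matrix_vector_mult_def)
    also have "\<dots> = complex_of_real (exp (- (\<Sum>p\<in>UNIV. \<Sum>p'\<in>UNIV. t $ p * t $ p' * (\<Sum>j\<in>UNIV. 1 * T $ p $ j * T $ p' $ j)) / 2))"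
      by (rule G.characteristic_function_normal_sum)
         (auto simp: indep_vars_std_gauss distr_std_gauss_component centered_normal_1)
    also have "\<dots> = complex_of_real (exp (- (\<Sum>p\<in>UNIV. \<Sum>p'\<in>UNIV. t $ p * t $ p' * (\<Sum>j\<in>J. v j * u p j * u p' j)) / 2))"
      by (simp add: cov matrix_matrix_mult_def transpose_def)
    also have "\<dots> = (CLINT x|distr M borel (\<lambda>\<omega>. \<chi> p. \<Sum>j\<in>J. u p j * X j \<omega>). iexp (t \<bullet> x))"
      by (subst integral_distr) (auto simp: characteristic_function_normal_sum[OF J ind d v])
    finally show "(CLINT x|distr M borel (\<lambda>\<omega>. \<chi> p. \<Sum>j\<in>J. u p j * X j \<omega>). iexp (t \<bullet> x)) =
      (CLINT x|distr std_gauss borel (\<lambda>r. T *v r). iexp (t \<bullet> x))" by simp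
  qed (auto intro!: prob_space_distr G.prob_space_distr)
qed

section \<open>Exponential bounds for the standard Gaussian measure\<close>

lemma std_gauss_density_eq:
  fixes x :: "real^'i::finite"
  shows "(\<Prod>c\<in>UNIV. std_normal_density (x $ c)) = (1 / sqrt (2 * pi)) ^ CARD('i) * exp (- ((norm x)^2) / 2)"
proof -
  have "(\<Prod>c\<in>UNIV. std_normal_density (x $ c)) = (\<Prod>c\<in>(UNIV::'i set). 1 / sqrt (2 * pi)) * (\<Prod>c\<in>UNIV. exp (- ((x $ c)^2) / 2))"
    unfolding std_normal_density_def by (rule prod.distrib)
  also have "(\<Prod>c\<in>UNIV. exp (- ((x $ c)^2) / 2)) = exp (\<Sum>c\<in>UNIV. - ((x $ c)^2) / 2)"
    by (simp add: exp_sum)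
  also have "(\<Sum>c\<in>UNIV. - ((x $ c)^2) / 2) = - ((norm x)^2) / 2"
    by (simp add: norm_vec_def L2_set_def sum_nonneg sum_negf sum_divide_distrib)
  finally show ?thesis by simp
qed

text \<open>Exponential Chebyshev inequality with \<open>exp (l * (norm x)^2 / 2)\<close>, which is
  integrable because \<open>l < 1\<close>. The rate falls short of the true one by the factor
  \<open>l\<close>, but \<open>K\<close> does not depend on \<open>R\<close>.\<close>

lemma std_gauss_tail:
  assumes l: "0 \<le> l" "l < 1"
  obtains K where "K > 0"
    "\<And>R. measure std_gauss {x :: real^('i::finite). R \<le> (norm x)^2} \<le> K * exp (- l * R / 2)"
proof -
  interpret G: prob_space "std_gauss :: (real^'i) measure" by (rule prob_space_std_gauss)
  \<comment> \<open>The tilted standard density is \<open>s\<close> times the centered normal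
    density of standard deviation \<open>s\<close>, so each coordinate contributes a factor
    \<open>s\<close>.\<close>
  define s where "s = 1 / sqrt (1 - l)"
  have s: "s > 0" "s^2 = 1 / (1 - l)" using l by (auto simp: s_def power_divide)
  have "(\<integral>\<^sup>+u. ennreal (exp (l * u^2 / 2)) \<partial>std_normal_distribution) = (\<integral>\<^sup>+u. ennreal s * ennreal (normal_density 0 s u) \<partial>lborel)"
  proof (subst nn_integral_density, simp, simp, intro nn_integral_cong)
    fix u :: real
    have "std_normal_density u * exp (l * u^2 / 2) = s * normal_density 0 s u"
    proof -
      have "- (u^2) / 2 + l * u^2 / 2 = - (u^2 / (2 * s^2))" using l by (simp add: s field_simps)
      moreover have "sqrt (2 * pi * s^2) = s * sqrt (2 * pi)" using s(1) by (simp add: real_sqrt_mult)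
      ultimately show ?thesis using s(1)
        by (simp add: std_normal_density_def normal_density_def exp_add[symmetric])
    qed
    then show "ennreal (std_normal_density u) * ennreal (exp (l * u^2 / 2)) = ennreal s * ennreal (normal_density 0 s u)"
      using s(1) by (simp flip: ennreal_mult)
  qed
  also have "\<dots> = ennreal s"
    using s(1) by (simp add: nn_integral_cmult nn_integral_eq_integral)
  finally have 1: "(\<integral>\<^sup>+u. ennreal (exp (l * u^2 / 2)) \<partial>std_normal_distribution) = ennreal s" .
  have "(\<integral>\<^sup>+x. ennreal (exp (l * (norm x)^2 / 2)) \<partial>(std_gauss :: (real^'i) measure)) =
     (\<integral>\<^sup>+x. (\<Prod>c\<in>UNIV. ennreal (exp (l * (x $ c)^2 / 2))) \<partial>(std_gauss :: (real^'i) measure))"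
    by (intro nn_integral_cong)
       (simp add: prod_ennreal exp_sum[symmetric] norm_vec_def L2_set_def sum_nonneg sum_distrib_left sum_divide_distrib)
  also have "\<dots> = ennreal s ^ CARD('i)"
    by (subst nn_integral_std_gauss_prod) (auto simp: 1)
  finally have 2: "(\<integral>\<^sup>+x. ennreal (exp (l * (norm x)^2 / 2)) \<partial>(std_gauss :: (real^'i) measure)) = ennreal (s ^ CARD('i))"
    using s(1) by (simp add: ennreal_power)
  show ?thesis
  proof (rule that[of "s ^ CARD('i)"])
    fix R
    have [measurable]: "{x :: real^'i. R \<le> (norm x)^2} \<in> sets borel" by measurable
    have "emeasure std_gauss {x :: real^'i. R \<le> (norm x)^2} = (\<integral>\<^sup>+x. indicator {x. R \<le> (norm x)^2} x \<partial>(std_gauss :: (real^'i) measure))"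
      by simp
    also have "\<dots> \<le> (\<integral>\<^sup>+x. ennreal (exp (- l * R / 2)) * ennreal (exp (l * (norm x)^2 / 2)) \<partial>(std_gauss :: (real^'i) measure))"
      using l(1) by (intro nn_integral_mono)
        (auto simp: indicator_def mult_left_mono simp flip: ennreal_mult exp_add intro!: ennreal_leI
           split: if_splits)
    also have "\<dots> = ennreal (exp (- l * R / 2)) * ennreal (s ^ CARD('i))"
      by (subst nn_integral_cmult) (auto simp: 2)
    also have "\<dots> = ennreal (s ^ CARD('i) * exp (- l * R / 2))"
      using s(1) by (simp add: mult.commute flip: ennreal_mult)
    finally show "measure std_gauss {x :: real^'i. R \<le> (norm x)^2} \<le> s ^ CARD('i) * exp (- l * R / 2)"
      using s(1) by (simp add: G.emeasure_eq_measure)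
  qed (use s(1) in simp)
qed

text \<open>The scaled vector is near \<open>r\<close> as soon as \<open>x\<close> lies in a ball of
  fixed radius around \<open>r / sqrt a\<close>. The volume of that ball is independent of
  \<open>a\<close>, and the density on it is controlled by the largest possible norm.\<close>

lemma std_gauss_ball_lower:
  fixes r :: "real^'i::finite"
  assumes "\<rho> > 0" "\<epsilon> > 0"
  obtains K where "K > 0"
    "\<And>a. 0 < a \<Longrightarrow> a \<le> 1 \<Longrightarrow>
       K * exp (- ((norm r)^2 / 2 + \<epsilon>) / a) \<le> measure std_gauss {x. norm (sqrt a *\<^sub>R x - r) < \<rho>}"
proof -
  interpret G: prob_space "std_gauss :: (real^'i) measure" by (rule prob_space_std_gauss)
  \<comment> \<open>The second bound ensures
    \<open>(norm r + \<eta>)^2 \<le> (norm r)^2 + 2 * \<epsilon>\<close>; the bound by 1 absorbs the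
    term \<open>\<eta>^2\<close> into \<open>2 * \<eta>\<close>.\<close>
  define \<eta> where "\<eta> = min (min 1 \<rho>) (\<epsilon> / (norm r + 1))"
  have n0: "norm r + 1 > 0" using norm_ge_zero[of r] by linarith
  have \<eta>: "\<eta> > 0" "\<eta> \<le> 1" "\<eta> \<le> \<rho>" "\<eta> * (norm r + 1) \<le> \<epsilon>"
    using assms n0 by (auto simp: \<eta>_def min_mult_distrib_right min_le_iff_disj)
  define D where "D = (1 / sqrt (2 * pi)) ^ CARD('i)"
  have D: "D > 0" by (simp add: D_def)
  define V where "V = unit_ball_vol (real CARD('i)) * \<eta> ^ CARD('i)"
  have V: "V > 0" using \<eta> by (simp add: V_def)
  show ?thesis
  proof (rule that[of "D * V"])
    fix a :: real assume a: "0 < a" "a \<le> 1"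
    let ?b = "ball (r /\<^sub>R sqrt a) \<eta>"
    have sa: "0 < sqrt a" "sqrt a \<le> 1" using a by auto
    have low: "D * exp (- ((norm r)^2 / 2 + \<epsilon>) / a) \<le> D * exp (- ((norm x)^2) / 2)" if "x \<in> ?b" for x
    proof -
      have "norm x \<le> norm (r /\<^sub>R sqrt a) + \<eta>"
        using that norm_triangle_ineq2[of x "r /\<^sub>R sqrt a"] by (simp add: dist_norm norm_minus_commute)
      also have "\<dots> = (norm r + sqrt a * \<eta>) / sqrt a" using sa by (simp add: field_simps)
      finally have "(norm x)^2 \<le> ((norm r + sqrt a * \<eta>) / sqrt a)^2" by (rule power_mono) simp
      also have "\<dots> = (norm r + sqrt a * \<eta>)^2 / a" using a by (simp add: power_divide)
      also have "\<dots> \<le> (norm r + \<eta>)^2 / a"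
        using sa a \<eta> by (intro divide_right_mono power_mono add_left_mono)
          (auto intro: mult_left_le_one_le)
      also have "(norm r + \<eta>)^2 \<le> (norm r)^2 + 2 * \<epsilon>"
      proof -
        have "(norm r + \<eta>)^2 = (norm r)^2 + 2 * (\<eta> * norm r) + \<eta> * \<eta>"
          by (simp add: power2_eq_square algebra_simps)
        also have "\<eta> * \<eta> \<le> 2 * \<eta>" using \<eta> mult_left_mono[of \<eta> 2 \<eta>] by simp
        finally show ?thesis using \<eta>(4) by (simp add: algebra_simps)
      qed
      finally have "(norm x)^2 \<le> ((norm r)^2 + 2 * \<epsilon>) / a" using a by (simp add: divide_right_mono)
      then have "- ((norm r)^2 / 2 + \<epsilon>) / a \<le> - ((norm x)^2) / 2" using a by (simp add: field_simps)
      then show ?thesis using D by simp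
    qed
    have sub: "?b \<subseteq> {x. norm (sqrt a *\<^sub>R x - r) < \<rho>}"
    proof
      fix x assume "x \<in> ?b"
      then have *: "norm (x - r /\<^sub>R sqrt a) < \<eta>" by (simp add: dist_norm norm_minus_commute)
      have "sqrt a *\<^sub>R x - r = sqrt a *\<^sub>R (x - r /\<^sub>R sqrt a)" using sa by (simp add: scaleR_diff_right)
      then have "norm (sqrt a *\<^sub>R x - r) = sqrt a * norm (x - r /\<^sub>R sqrt a)" using sa by simp
      also have "\<dots> \<le> norm (x - r /\<^sub>R sqrt a)" using sa by (intro mult_left_le_one_le) auto
      finally show "x \<in> {x. norm (sqrt a *\<^sub>R x - r) < \<rho>}" using * \<eta>(3) by simp
    qed
    have [measurable]: "{x :: real^'i. norm (sqrt a *\<^sub>R x - r) < \<rho>} \<in> sets borel" by measurable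
    have "ennreal (D * V * exp (- ((norm r)^2 / 2 + \<epsilon>) / a)) =
      (\<integral>\<^sup>+x. ennreal (D * exp (- ((norm r)^2 / 2 + \<epsilon>) / a)) * indicator ?b x \<partial>lborel)"
      using \<eta>(1) D V by (subst nn_integral_cmult_indicator)
        (auto simp: emeasure_ball V_def[symmetric] mult_ac simp flip: ennreal_mult)
    also have "\<dots> \<le> (\<integral>\<^sup>+x. ennreal (\<Prod>c\<in>UNIV. std_normal_density (x $ c)) * indicator ?b x \<partial>lborel)"
      using low unfolding std_gauss_density_eq D_def[symmetric]
      by (intro nn_integral_mono) (auto simp: indicator_def intro!: ennreal_leI)
    also have "\<dots> = emeasure std_gauss ?b" unfolding std_gauss_def by (subst emeasure_density) auto
    also have "\<dots> \<le> emeasure std_gauss {x. norm (sqrt a *\<^sub>R x - r) < \<rho>}"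
      using sub by (intro emeasure_mono) auto
    finally show "D * V * exp (- ((norm r)^2 / 2 + \<epsilon>) / a) \<le> measure std_gauss {x. norm (sqrt a *\<^sub>R x - r) < \<rho>}"
      by (simp add: G.emeasure_eq_measure)
  qed (use D V in simp)
qed

section \<open>Empirical covariances of a network\<close>

text \<open>Splitting the parameters by layer exposes independent blocks:
  \<open>lower_params w l\<close> determines everything up to layer \<open>l\<close>, and
  \<open>layer_params w (Suc l)\<close> is the fresh randomness of the next layer.\<close>

definition layer_params :: "(nat \<Rightarrow> nat) \<Rightarrow> nat \<Rightarrow> param set" where
  "layer_params w l = {Bias l i | i. i < w l} \<union> {Weight l i j | i j. i < w l \<and> j < w (l - 1)}"

definition lower_params :: "(nat \<Rightarrow> nat) \<Rightarrow> nat \<Rightarrow> param set" where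
  "lower_params w l = (\<Union>k\<in>{1..l}. layer_params w k)"

lemma params_eq_lower_params: "params L w = lower_params w (Suc L)"
  by (auto simp: params_def lower_params_def layer_params_def Bex_def)

lemma lower_params_Suc: "lower_params w (Suc l) = lower_params w l \<union> layer_params w (Suc l)"
  by (auto simp: lower_params_def atLeastAtMostSuc_conv)

lemma lower_layer_disjoint: "lower_params w l \<inter> layer_params w (Suc l) = {}"
  by (auto simp: lower_params_def layer_params_def)

lemma lower_params_mono: "k \<le> l \<Longrightarrow> lower_params w k \<subseteq> lower_params w l"
  by (force simp: lower_params_def)

lemma layer_params_eq_images:
  "layer_params w l = Bias l ` {..<w l} \<union> (\<lambda>(i, j). Weight l i j) ` ({..<w l} \<times> {..<w (l - 1)})"
  by (auto simp: layer_params_def)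

lemma finite_layer_params: "finite (layer_params w l)"
  by (simp add: layer_params_eq_images)

lemma sum_layer_params:
  "(\<Sum>p\<in>layer_params w (Suc l). F p) =
    (\<Sum>i<w (Suc l). F (Bias (Suc l) i) + (\<Sum>j<w l. F (Weight (Suc l) i j)))"
proof -
  have "(\<Sum>p\<in>layer_params w (Suc l). F p) = (\<Sum>p\<in>Bias (Suc l) ` {..<w (Suc l)}. F p) +
     (\<Sum>p\<in>(\<lambda>(i, j). Weight (Suc l) i j) ` ({..<w (Suc l)} \<times> {..<w l}). F p)"
    unfolding layer_params_eq_images by (subst sum.union_disjoint) auto
  also have "\<dots> = (\<Sum>i<w (Suc l). F (Bias (Suc l) i)) + (\<Sum>i<w (Suc l). \<Sum>j<w l. F (Weight (Suc l) i j))"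
    by (subst (1 2) sum.reindex) (auto simp: inj_on_def sum.cartesian_product case_prod_unfold)
  finally show ?thesis by (simp add: sum.distrib)
qed

text \<open>The values fed into layer \<open>Suc l\<close>.\<close>
definition feat ::
  "(param \<Rightarrow> real) \<Rightarrow> (nat \<Rightarrow> nat) \<Rightarrow> (real \<Rightarrow> real) \<Rightarrow> ('a \<Rightarrow> nat \<Rightarrow> real) \<Rightarrow> nat \<Rightarrow> 'a \<Rightarrow> nat \<Rightarrow> real" where
  "feat th w sg x l a j = (if l = 0 then x a j else sg (preact th w sg (x a) l j))"

lemma preact_Suc:
  "preact th w sg (x a) (Suc l) i =
     th (Bias (Suc l) i) + (\<Sum>j<w l. th (Weight (Suc l) i j) * feat th w sg x l a j)"
  by (cases l) (simp_all add: feat_def)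

lemma feat_Suc:
  "feat th w sg x (Suc l) a i =
     sg (th (Bias (Suc l) i) + (\<Sum>j<w l. th (Weight (Suc l) i j) * feat th w sg x l a j))"
  unfolding preact_Suc[symmetric] by (simp add: feat_def)

lemma Bias_in_layer_params: "i < w (Suc l) \<Longrightarrow> Bias (Suc l) i \<in> layer_params w (Suc l)"
  and Weight_in_layer_params: "i < w (Suc l) \<Longrightarrow> j < w l \<Longrightarrow> Weight (Suc l) i j \<in> layer_params w (Suc l)"
  by (auto simp: layer_params_def)

lemma feat_cong:
  assumes "\<And>p. p \<in> lower_params w l \<Longrightarrow> th p = th' p" "j < w l"
  shows "feat th w sg x l a j = feat th' w sg x l a j"
  using assms
proof (induction l arbitrary: j)
  case 0
  then show ?case by (simp add: feat_def)
next
  case (Suc l)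
  have "th (Bias (Suc l) j) = th' (Bias (Suc l) j)"
    using Suc.prems by (simp add: lower_params_Suc Bias_in_layer_params)
  moreover have "(\<Sum>i<w l. th (Weight (Suc l) j i) * feat th w sg x l a i) =
      (\<Sum>i<w l. th' (Weight (Suc l) j i) * feat th' w sg x l a i)"
  proof (rule sum.cong)
    fix i assume i: "i \<in> {..<w l}"
    then have "th (Weight (Suc l) j i) = th' (Weight (Suc l) j i)"
      using Suc.prems by (simp add: lower_params_Suc Weight_in_layer_params)
    moreover have "feat th w sg x l a i = feat th' w sg x l a i"
      using Suc.prems i by (intro Suc.IH) (auto simp: lower_params_Suc)
    ultimately show "th (Weight (Suc l) j i) * feat th w sg x l a i =
        th' (Weight (Suc l) j i) * feat th' w sg x l a i" by simp
  qed simp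
  ultimately show ?case by (simp add: feat_Suc)
qed

lemma feat_measurable:
  assumes "\<And>p. p \<in> lower_params w l \<Longrightarrow> (\<lambda>\<omega>. th \<omega> p) \<in> borel_measurable N" "j < w l"
    and [measurable]: "sg \<in> borel_measurable borel"
  shows "(\<lambda>\<omega>. feat (th \<omega>) w sg x l a j) \<in> borel_measurable N"
  using assms(1,2)
proof (induction l arbitrary: j)
  case 0
  then show ?case by (simp add: feat_def)
next
  case (Suc l)
  have [measurable]: "(\<lambda>\<omega>. th \<omega> (Bias (Suc l) j)) \<in> borel_measurable N"
    using Suc.prems by (simp add: lower_params_Suc Bias_in_layer_params)
  have [measurable]: "(\<lambda>\<omega>. th \<omega> (Weight (Suc l) j i)) \<in> borel_measurable N"
    "(\<lambda>\<omega>. feat (th \<omega>) w sg x l a i) \<in> borel_measurable N" if "i < w l" for i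
    using Suc.prems that Suc.IH[of i] by (auto simp: lower_params_Suc Weight_in_layer_params)
  have "(\<lambda>\<omega>. th \<omega> (Bias (Suc l) j) + (\<Sum>i<w l. th \<omega> (Weight (Suc l) j i) * feat (th \<omega>) w sg x l a i))
      \<in> borel_measurable N"
    by measurable
  from measurable_compose[OF this assms(3)] show ?case by (simp add: feat_Suc)
qed

text \<open>The covariance, over pairs of inputs, of a single neuron of layer \<open>Suc l\<close>
  conditionally on all parameters up to layer \<open>l\<close>.\<close>

definition emp_cov ::
  "real \<Rightarrow> real \<Rightarrow> (param \<Rightarrow> real) \<Rightarrow> (nat \<Rightarrow> nat) \<Rightarrow> (real \<Rightarrow> real) \<Rightarrow> ('a \<Rightarrow> nat \<Rightarrow> real) \<Rightarrow> nat \<Rightarrow> real^'a^'a" where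
  "emp_cov Cb CW th w sg x l =
     (\<chi> a b. Cb + CW / real (w l) * (\<Sum>j<w l. feat th w sg x l a j * feat th w sg x l b j))"

lemma emp_cov_0: "emp_cov Cb CW th w sg x 0 = ghat0 Cb CW (w 0) x"
  by (simp add: emp_cov_def ghat0_def feat_def)

lemma emp_cov_cong:
  assumes "\<And>p. p \<in> lower_params w l \<Longrightarrow> th p = th' p"
  shows "emp_cov Cb CW th w sg x l = emp_cov Cb CW th' w sg x l"
proof -
  have "feat th w sg x l a j = feat th' w sg x l a j" if "j < w l" for a j
    using assms that by (rule feat_cong)
  then show ?thesis by (simp add: emp_cov_def vec_eq_iff)
qed

lemma emp_cov_measurable:
  fixes x :: "'a::finite \<Rightarrow> nat \<Rightarrow> real"
  assumes th: "\<And>p. p \<in> lower_params w l \<Longrightarrow> (\<lambda>\<omega>. th \<omega> p) \<in> borel_measurable N"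
    and sg: "sg \<in> borel_measurable borel"
  shows "(\<lambda>\<omega>. emp_cov Cb CW (th \<omega>) w sg x l) \<in> borel_measurable N"
proof -
  have [measurable]: "(\<lambda>\<omega>. feat (th \<omega>) w sg x l a j) \<in> borel_measurable N" if "j < w l" for a j
    using th that sg by (rule feat_measurable)
  have "(\<lambda>\<omega>. emp_cov Cb CW (th \<omega>) w sg x l $ a $ b) \<in> borel_measurable N" for a b
    unfolding emp_cov_def by simp
  then show ?thesis
    by (subst borel_measurable_euclidean_space) (auto simp: Basis_vec_def inner_axis)
qed

section \<open>The covariance recursion and its continuity\<close>

lemma sym_psd_shift:
  assumes "sym_psd S" "0 \<le> c" "0 \<le> k"
  shows "sym_psd (\<chi> a b. c + k * S $ a $ b)"
proof -
  have 1: "S $ a $ b = S $ b $ a" for a b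
    using assms(1) unfolding sym_psd_def transpose_def by (metis vec_lambda_beta)
  have "v \<bullet> ((\<chi> a b. c + k * S $ a $ b) *v v) = c * (\<Sum>a\<in>UNIV. v $ a)^2 + k * (v \<bullet> (S *v v))" for v
    by (simp add: inner_vec_def matrix_vector_mult_def power2_eq_square sum_product sum_distrib_left
        sum.distrib distrib_left distrib_right mult_ac)
  then have "psd_mat (\<chi> a b. c + k * S $ a $ b)"
    using assms by (simp add: psd_mat_def sym_psd_def)
  then show ?thesis using 1 by (simp add: sym_psd_def transpose_def vec_eq_iff)
qed

lemma sym_psd_gram:
  fixes f :: "'a::finite \<Rightarrow> 'j \<Rightarrow> real"
  shows "sym_psd (\<chi> a b. \<Sum>j\<in>J. f a j * f b j)"
proof -
  have "v \<bullet> ((\<chi> a b. \<Sum>j\<in>J. f a j * f b j) *v v) = (\<Sum>j\<in>J. (\<Sum>a\<in>UNIV. v $ a * f a j)^2)" for v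
  proof -
    have "v \<bullet> ((\<chi> a b. \<Sum>j\<in>J. f a j * f b j) *v v) =
      (\<Sum>a\<in>UNIV. \<Sum>b\<in>UNIV. \<Sum>j\<in>J. v $ a * f a j * (v $ b * f b j))"
      by (simp add: inner_vec_def matrix_vector_mult_def sum_distrib_left sum_distrib_right mult_ac)
    also have "\<dots> = (\<Sum>j\<in>J. \<Sum>a\<in>UNIV. \<Sum>b\<in>UNIV. v $ a * f a j * (v $ b * f b j))"
      by (subst (2) sum.swap, subst sum.swap) simp
    finally show ?thesis by (simp add: power2_eq_square sum_product)
  qed
  then show ?thesis
    by (auto simp: sym_psd_def psd_mat_def transpose_def vec_eq_iff mult.commute intro: sum_nonneg)
qed

lemma sym_psd_emp_cov: "0 \<le> Cb \<Longrightarrow> 0 \<le> CW \<Longrightarrow> sym_psd (emp_cov Cb CW th w sg x l)"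
  using sym_psd_shift[OF sym_psd_gram[of "feat th w sg x l" "{..<w l}"], of Cb "CW / real (w l)"]
  by (simp add: emp_cov_def)

lemma y_mat_eq:
  assumes [measurable]: "sg \<in> borel_measurable borel"
  shows "y_mat sg q $ a $ b =
    (LINT r|std_gauss. sg ((psd_sqrt q *v r) $ a) * sg ((psd_sqrt q *v r) $ b))"
proof -
  have [measurable]: "(\<lambda>r. (psd_sqrt q *v r) $ c) \<in> borel_measurable borel" for c
    unfolding matrix_vector_mult_def by simp
  show ?thesis unfolding std_gauss_def y_mat_def
    by (subst integral_density) (auto intro!: prod_nonneg)
qed

text \<open>One step of the recursion behind \<open>ghat\<close>, isolated as a map because the
  concentration argument propagates errors through it by continuity.\<close>

definition next_cov :: "real \<Rightarrow> real \<Rightarrow> (real \<Rightarrow> real) \<Rightarrow> real^'a^'a \<Rightarrow> real^'a^'a" where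
  "next_cov Cb CW sg q = (\<chi> a b. Cb + CW * y_mat sg q $ a $ b)"

lemma ghat_Suc: "ghat Cb CW sg n0 x (Suc l) = next_cov Cb CW sg (ghat Cb CW sg n0 x l)"
  by (simp add: next_cov_def)

context
  fixes sg :: "real \<Rightarrow> real" and B :: real
  assumes sg_cont: "continuous_on UNIV sg" and sg_bd: "\<And>u. \<bar>sg u\<bar> \<le> B"
begin

lemma sg_measurable [measurable]: "sg \<in> borel_measurable borel"
  using sg_cont by (rule borel_measurable_continuous_onI)

lemma abs_sg_mult_le: "\<bar>sg u * sg v\<bar> \<le> B\<^sup>2"
  unfolding abs_mult power2_eq_square using sg_bd abs_ge_zero order_trans
  by (intro mult_mono) blast+

lemma matrix_vector_component_measurable [measurable]:
  "(\<lambda>r. ((S :: real^'a::finite^'a) *v r) $ c) \<in> borel_measurable borel"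
  unfolding matrix_vector_mult_def by simp

lemma integrable_y_mat:
  "integrable std_gauss (\<lambda>r. sg (((S :: real^'a::finite^'a) *v r) $ a) * sg ((S *v r) $ b))"
proof -
  interpret G: prob_space "std_gauss :: (real^'a) measure" by (rule prob_space_std_gauss)
  show ?thesis by (rule G.integrable_const_bound[of _ "B\<^sup>2"]) (auto simp: abs_sg_mult_le simp del: abs_mult)
qed

lemma sym_psd_y_mat: "sym_psd (y_mat sg q :: real^'a::finite^'a)"
proof -
  let ?s = "\<lambda>r a. sg ((psd_sqrt q *v r) $ a)"
  have "v \<bullet> (y_mat sg q *v v) = (LINT r|std_gauss. (\<Sum>a\<in>UNIV. v $ a * ?s r a)^2)" for v
  proof -
    have "(LINT r|std_gauss. (\<Sum>a\<in>UNIV. v $ a * ?s r a)^2) =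
      (LINT r|std_gauss. (\<Sum>a\<in>UNIV. \<Sum>b\<in>UNIV. v $ a * v $ b * (?s r a * ?s r b)))"
      by (simp add: power2_eq_square sum_product mult_ac)
    also have "\<dots> = (\<Sum>a\<in>UNIV. \<Sum>b\<in>UNIV. v $ a * v $ b * y_mat sg q $ a $ b)"
      by (simp add: y_mat_eq integrable_y_mat)
    finally show ?thesis
      by (simp add: inner_vec_def matrix_vector_mult_def sum_distrib_left mult_ac)
  qed
  then have "psd_mat (y_mat sg q)" by (simp add: psd_mat_def)
  then show ?thesis by (simp add: sym_psd_def transpose_def vec_eq_iff y_mat_eq mult.commute)
qed

text \<open>The integrating measure \<open>std_gauss\<close> is the same for all \<open>q\<close>,
  which enters only through its square root. Continuity of the root and of \<open>sg\<close> gives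
  pointwise convergence, and the constant \<open>B\<^sup>2\<close> dominates.\<close>

lemma continuous_on_y_mat: "continuous_on {q. sym_psd q} (y_mat sg :: real^'a::finite^'a \<Rightarrow> _)"
proof (rule continuous_on_sequentiallyI, clarify)
  fix u :: "nat \<Rightarrow> real^'a^'a" and q
  assume u: "\<forall>n. u n \<in> {q. sym_psd q}" and q: "sym_psd q" and lim: "u \<longlonglongrightarrow> q"
  interpret G: prob_space "std_gauss :: (real^'a) measure" by (rule prob_space_std_gauss)
  have "(\<lambda>n. psd_sqrt (u n)) \<longlonglongrightarrow> psd_sqrt q"
    using continuous_on_psd_sqrt u q lim unfolding continuous_on_sequentially by (auto simp: o_def)
  then have s: "(\<lambda>n. sg ((psd_sqrt (u n) *v r) $ c)) \<longlonglongrightarrow> sg ((psd_sqrt q *v r) $ c)" for r c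
    using sg_cont unfolding matrix_vector_mult_def
    by (auto intro!: continuous_on_tendsto_compose[OF sg_cont] tendsto_intros)
  show "(\<lambda>n. y_mat sg (u n)) \<longlonglongrightarrow> y_mat sg q"
  proof (intro vec_tendstoI)
    fix a b
    show "(\<lambda>n. y_mat sg (u n) $ a $ b) \<longlonglongrightarrow> y_mat sg q $ a $ b"
      unfolding y_mat_eq[OF sg_measurable]
      by (rule integral_dominated_convergence[where w="\<lambda>_. B\<^sup>2"])
        (auto intro!: tendsto_mult s simp: abs_sg_mult_le simp del: abs_mult)
  qed
qed

lemma sym_psd_ghat:
  assumes "0 \<le> Cb" "0 \<le> CW"
  shows "sym_psd (ghat Cb CW sg n0 (x :: 'a::finite \<Rightarrow> _) l)"
proof (cases l)
  case 0
  then show ?thesis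
    using sym_psd_shift[OF sym_psd_gram[of x "{..<n0}"], of Cb "CW / real n0"] assms by (simp add: ghat0_def)
next
  case (Suc k)
  then show ?thesis using sym_psd_shift[OF sym_psd_y_mat assms] by simp
qed

lemma continuous_on_next_cov:
  "continuous_on {q. sym_psd q} (next_cov Cb CW sg :: real^'a::finite^'a \<Rightarrow> _)"
  unfolding next_cov_def
  by (intro continuous_on_vec_lambda continuous_intros continuous_on_y_mat)

end

text \<open>Conditioning on \<open>X\<close> in the form of Fubini's theorem for the product law:
  sections over \<open>A\<close> have mass at most \<beta>, all others at most 1.\<close>

lemma (in prob_space) prob_le_section_bound:
  assumes ind: "indep_var S X T Y" and A: "A \<in> sets S" and H[measurable]: "H \<in> sets (S \<Otimes>\<^sub>M T)"
    and \<beta>: "0 \<le> \<beta>" and sec: "\<And>x. x \<in> A \<Longrightarrow> prob {\<omega> \<in> space M. (x, Y \<omega>) \<in> H} \<le> \<beta>"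
  shows "prob {\<omega> \<in> space M. (X \<omega>, Y \<omega>) \<in> H} \<le> \<beta> + prob {\<omega> \<in> space M. X \<omega> \<notin> A}"
proof -
  have X[measurable]: "X \<in> measurable M S" and Y[measurable]: "Y \<in> measurable M T"
    and eq: "distr M S X \<Otimes>\<^sub>M distr M T Y = distr M (S \<Otimes>\<^sub>M T) (\<lambda>\<omega>. (X \<omega>, Y \<omega>))"
    using ind by (auto simp: indep_var_distribution_eq)
  interpret X: prob_space "distr M S X" by (rule prob_space_distr) (rule X)
  interpret Y: prob_space "distr M T Y" by (rule prob_space_distr) (rule Y)
  have "emeasure M {\<omega> \<in> space M. (X \<omega>, Y \<omega>) \<in> H} = emeasure (distr M S X \<Otimes>\<^sub>M distr M T Y) H"
    unfolding eq by (subst emeasure_distr) (auto intro!: arg_cong2[where f=emeasure])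
  also have "\<dots> = (\<integral>\<^sup>+x. emeasure (distr M T Y) (Pair x -` H) \<partial>distr M S X)"
    by (rule Y.emeasure_pair_measure_alt) (simp cong: sets_pair_measure_cong)
  also have "\<dots> \<le> (\<integral>\<^sup>+x. ennreal \<beta> + indicator (space S - A) x \<partial>distr M S X)"
  proof (rule nn_integral_mono)
    fix x assume x: "x \<in> space (distr M S X)"
    show "emeasure (distr M T Y) (Pair x -` H) \<le> ennreal \<beta> + indicator (space S - A) x"
    proof (cases "x \<in> A")
      case True
      have "emeasure (distr M T Y) (Pair x -` H) = emeasure M {\<omega> \<in> space M. (x, Y \<omega>) \<in> H}"
        by (subst emeasure_distr) (auto intro!: arg_cong2[where f=emeasure] sets_Pair1)
      also have "\<dots> \<le> ennreal \<beta>" using sec[OF True] by (simp add: emeasure_eq_measure ennreal_leI)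
      finally show ?thesis using True by simp
    next
      case False
      then show ?thesis using x Y.emeasure_le_1[of "Pair x -` H"] by (simp add: add_increasing)
    qed
  qed
  also have "\<dots> = ennreal \<beta> + emeasure (distr M S X) (space S - A)"
    using A by (subst nn_integral_add) (auto simp: X.emeasure_space_1[simplified])
  also have "emeasure (distr M S X) (space S - A) = emeasure M {\<omega> \<in> space M. X \<omega> \<notin> A}"
    using A measurable_space[OF X] by (subst emeasure_distr) (auto intro!: arg_cong2[where f=emeasure])
  finally show ?thesis
    using \<beta> by (simp add: emeasure_eq_measure flip: ennreal_plus)
qed

section \<open>Large deviations of Gaussian mixtures\<close>

text \<open>The contraction of the standard Gaussian rate along \<open>mat_act G\<close>. Off the
  range of that map the infimum is over the empty set, hence infinite.\<close>

definition gauss_rate :: "real^'a::finite^'a \<Rightarrow> real^('a \<times> 'k::finite) \<Rightarrow> ereal" where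
  "gauss_rate G z = (INF r \<in> {r. mat_act G r = z}. ereal (norm r ^ 2 / 2))"

lemma bounded_bilinear_mat_act:
  "bounded_bilinear (mat_act :: real^'a::finite^'a \<Rightarrow> real^('a \<times> 'k::finite) \<Rightarrow> _)"
proof -
  have "bilinear (mat_act :: real^'a::finite^'a \<Rightarrow> real^('a \<times> 'k::finite) \<Rightarrow> _)"
    unfolding bilinear_def
    by (auto intro!: linearI simp: mat_act_def vec_eq_iff distrib_left distrib_right sum.distrib
        sum_distrib_left mult_ac)
  then show ?thesis by (simp add: bilinear_conv_bounded_bilinear)
qed

interpretation mat_act: bounded_bilinear "mat_act :: real^'a::finite^'a \<Rightarrow> real^('a \<times> 'k::finite) \<Rightarrow> _"
  by (rule bounded_bilinear_mat_act)

lemma continuous_on_mat_act: "continuous_on A (mat_act G)"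
  by (intro linear_continuous_on mat_act.bounded_linear_right)

text \<open>Continuity of the root at \<open>g\<close>, combined with bilinearity of
  \<open>mat_act\<close>. The radius \<eta> is chosen before \<open>r\<close>, and the error is
  linear in \<open>norm r\<close>.\<close>

lemma mat_act_psd_sqrt_close:
  fixes g :: "real^'a::finite^'a"
  assumes g: "sym_psd g" and e: "e > 0"
  obtains \<eta> where "\<eta> > 0" "\<And>q (r :: real^('a \<times> 'k::finite)). sym_psd q \<Longrightarrow> dist q g < \<eta> \<Longrightarrow>
     norm (mat_act (psd_sqrt q) r - mat_act (psd_sqrt g) r) \<le> e * norm r"
proof -
  obtain K where K: "K > 0" "\<And>S (r :: real^('a \<times> 'k)). norm (mat_act S r) \<le> norm S * norm r * K"
    using mat_act.pos_bounded by blast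
  have "e / K > 0" using e K by simp
  then obtain \<eta> where \<eta>: "\<eta> > 0"
    "\<And>q. sym_psd q \<Longrightarrow> dist q g < \<eta> \<Longrightarrow> dist (psd_sqrt q) (psd_sqrt g) < e / K"
    using continuous_on_psd_sqrt g unfolding continuous_on_iff by fastforce
  show ?thesis
  proof (rule that[OF \<eta>(1)])
    fix q and r :: "real^('a \<times> 'k)"
    assume "sym_psd q" "dist q g < \<eta>"
    then have "norm (psd_sqrt q - psd_sqrt g) \<le> e / K" using \<eta>(2)[of q] by (simp add: dist_norm)
    then have "norm (psd_sqrt q - psd_sqrt g) * norm r * K \<le> e / K * norm r * K"
      using K(1) by (intro mult_right_mono) auto
    also have "\<dots> = e * norm r" using K(1) by simp
    finally have "norm (psd_sqrt q - psd_sqrt g) * norm r * K \<le> e * norm r" .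
    then show "norm (mat_act (psd_sqrt q) r - mat_act (psd_sqrt g) r) \<le> e * norm r"
      using K(2)[of "psd_sqrt q - psd_sqrt g" r] by (simp add: mat_act.diff_left)
  qed
qed

lemma gauss_rate_le: "gauss_rate G (mat_act G r) \<le> ereal (norm r ^ 2 / 2)"
  unfolding gauss_rate_def by (rule INF_lower) simp

text \<open>The fibre over \<open>z\<close> is closed, so when nonempty it has a point closest to 0
  and the infimum is attained. Sublevel sets are thus linear images of closed balls, hence
  compact.\<close>

lemma gauss_rate_le_iff:
  assumes "c \<ge> 0"
  shows "gauss_rate G z \<le> ereal c \<longleftrightarrow> (\<exists>r. mat_act G r = z \<and> norm r \<le> sqrt (2 * c))"
proof
  assume le: "gauss_rate G z \<le> ereal c"
  let ?S = "{r. mat_act G r = z}"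
  have "?S \<noteq> {}"
  proof
    assume "?S = {}"
    then have "gauss_rate G z = top" unfolding gauss_rate_def by (simp only: image_empty Inf_empty)
    then show False using le by (simp add: top_ereal_def)
  qed
  moreover have "closed ?S"
    by (intro closed_Collect_eq continuous_on_mat_act continuous_on_const)
  ultimately obtain r where r: "r \<in> ?S" "\<And>s. s \<in> ?S \<Longrightarrow> dist 0 r \<le> dist 0 s"
    using distance_attains_inf[of ?S 0] by blast
  have "ereal (norm r ^ 2 / 2) \<le> gauss_rate G z" unfolding gauss_rate_def
    using r(2) by (intro INF_greatest) (auto intro!: power_mono)
  then have "ereal (norm r ^ 2 / 2) \<le> ereal c" using le by (rule order_trans)
  then have "norm r \<le> sqrt (2 * c)" by (intro real_le_rsqrt) simp
  then show "\<exists>r. mat_act G r = z \<and> norm r \<le> sqrt (2 * c)" using r(1) by auto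
next
  assume "\<exists>r. mat_act G r = z \<and> norm r \<le> sqrt (2 * c)"
  then obtain r where r: "mat_act G r = z" "norm r \<le> sqrt (2 * c)" by blast
  have "norm r ^ 2 \<le> 2 * c" using power_mono[OF r(2), of 2] assms by simp
  then show "gauss_rate G z \<le> ereal c"
    using gauss_rate_le[of G r] r(1) by (auto elim!: order_trans)
qed

lemma good_rate_function_gauss_rate:
  "good_rate_function (gauss_rate G :: real^('a::finite \<times> 'k::finite) \<Rightarrow> ereal)"
proof -
  have nn: "0 \<le> gauss_rate G z" for z :: "real^('a \<times> 'k)"
    unfolding gauss_rate_def by (rule INF_greatest) simp
  have cpt: "compact {z :: real^('a \<times> 'k). gauss_rate G z \<le> ereal c}" for c :: real
  proof (cases "c \<ge> 0")
    case True
    then have "{z :: real^('a \<times> 'k). gauss_rate G z \<le> ereal c} = mat_act G ` cball 0 (sqrt (2 * c))"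
      by (auto simp: gauss_rate_le_iff)
    then show ?thesis
      using compact_continuous_image[OF continuous_on_mat_act compact_cball] by simp
  next
    case False
    have "\<not> gauss_rate G z \<le> ereal c" for z :: "real^('a \<times> 'k)"
      using nn[of z] False by (metis ereal_less_eq(3) order_trans zero_ereal_def)
    then show ?thesis by simp
  qed
  then show ?thesis using nn by (simp add: good_rate_function_def compact_imp_closed)
qed

lemma
  fixes A :: "real^'n^'m"
  assumes "invertible A"
  shows matrix_inv_right: "A ** matrix_inv A = mat 1" and matrix_inv_left: "matrix_inv A ** A = mat 1"
  using someI_ex[OF assms[unfolded invertible_def]] by (simp_all add: matrix_inv_def)

lemma gauss_rate_invertible:
  assumes "invertible G"
  shows "gauss_rate G z = ereal (norm (mat_act (matrix_inv G) z) ^ 2 / 2)"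
proof -
  have comp: "mat_act S (mat_act T r) = mat_act (S ** T) r" for S T :: "real^'a^'a" and r :: "real^('a \<times> 'b)"
    unfolding mat_act_def matrix_matrix_mult_def vec_eq_iff
    by (simp add: sum_distrib_left sum_distrib_right mult.assoc) (intro allI sum.swap)
  have one: "mat_act (mat 1) r = r" for r :: "real^('a \<times> 'b)"
    unfolding mat_act_def mat_def vec_eq_iff by (simp add: if_distrib[of "\<lambda>u. u * _"] cong: if_cong)
  have "{r. mat_act G r = z} = {mat_act (matrix_inv G) z}"
    using matrix_inv_left[OF assms] matrix_inv_right[OF assms] by (auto simp: comp one)
  then show ?thesis by (simp add: gauss_rate_def)
qed

section \<open>From Gaussian bounds to the logarithmic scale\<close>

lemma eln_le: "p \<le> B \<Longrightarrow> B > 0 \<Longrightarrow> eln p \<le> ereal (ln B)"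
  by (simp add: eln_def)

lemma le_eln: "B \<le> p \<Longrightarrow> B > 0 \<Longrightarrow> ereal (ln B) \<le> eln p"
  by (simp add: eln_def)

text \<open>After taking logarithms and multiplying by \<open>a n\<close>, the claim compares a
  quantity that is eventually at most \<open>1 + \<bar>E\<bar>\<close> with
  \<open>c * (a n * v n)\<close>, which tends to infinity.\<close>

lemma eventually_exp_negligible:
  fixes a v :: "nat \<Rightarrow> real"
  assumes a: "\<And>n. a n > 0" "a \<longlonglongrightarrow> 0" and av: "filterlim (\<lambda>n. a n * v n) at_top sequentially"
    and c: "c > 0" and K: "K > 0"
  shows "\<forall>\<^sub>F n in sequentially. C * exp (- c * v n) \<le> K * exp (- E / a n)"
proof -
  \<comment> \<open>A positive substitute for \<open>C\<close>, whose sign is unknown, so that the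
    logarithm of \<open>B / K\<close> makes sense.\<close>
  define B where "B = \<bar>C\<bar> + 1"
  have B: "B > 0" "C \<le> B" by (auto simp: B_def)
  have "\<forall>\<^sub>F n in sequentially. (\<bar>E\<bar> + 1) / c \<le> a n * v n"
    using av by (simp add: filterlim_at_top)
  moreover have "\<forall>\<^sub>F n in sequentially. a n < 1 / (\<bar>ln (B / K)\<bar> + 1)"
    using a(2) by (rule order_tendstoD) (simp add: add_nonneg_pos)
  ultimately show ?thesis
  proof eventually_elim
    case (elim n)
    have "a n * (\<bar>ln (B / K)\<bar> + 1) \<le> 1" using elim(2) by (simp add: field_simps)
    then have "a n * ln (B / K) \<le> 1"
      using mult_left_mono[of "ln (B / K)" "\<bar>ln (B / K)\<bar> + 1" "a n"] a(1)[of n] by linarith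
    moreover have "\<bar>E\<bar> + 1 \<le> c * (a n * v n)" using elim(1) c by (simp add: field_simps)
    ultimately have "a n * ln (B / K) + E \<le> c * (a n * v n)" by linarith
    then have "ln (B / K) - c * v n \<le> - E / a n" using a(1)[of n] by (simp add: field_simps)
    then have "exp (ln (B / K) - c * v n) \<le> exp (- E / a n)" by simp
    then have "B * exp (- c * v n) \<le> K * exp (- E / a n)"
      using B K by (simp add: exp_diff exp_minus field_simps)
    then show ?case using mult_right_mono[OF B(2) exp_ge_zero, of "- c * v n"] by linarith
  qed
qed

text \<open>
  Assumption \<open>mix\<close> bounds only from above, but applied to the complement of \<open>S\<close> it also gives the
  lower bound.
\<close>

theorem LDP_gaussian_mixture:
  fixes \<mu> :: "nat \<Rightarrow> (real^('a::finite \<times> 'k::finite)) measure" and g :: "real^'a^'a"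
    and a v :: "nat \<Rightarrow> real"
  assumes g: "sym_psd g" and \<mu>: "\<And>n. prob_space (\<mu> n)" "\<And>n. sets (\<mu> n) = sets borel"
    and a: "\<And>n. a n > 0" "a \<longlonglongrightarrow> 0" and av: "filterlim (\<lambda>n. a n * v n) at_top sequentially"
    and mix: "\<And>\<eta>. \<eta> > 0 \<Longrightarrow> \<exists>C c. c > 0 \<and> (\<forall>\<^sub>F n in sequentially. \<forall>S\<in>sets borel. \<forall>\<beta>.
       (\<forall>q. sym_psd q \<longrightarrow> dist q g < \<eta> \<longrightarrow>
          measure std_gauss {r. sqrt (a n) *\<^sub>R mat_act (psd_sqrt q) r \<in> S} \<le> \<beta>) \<longrightarrow>
       measure (\<mu> n) S \<le> \<beta> + C * exp (- c * v n))"
  shows "LDP \<mu> (\<lambda>n. 1 / a n) (gauss_rate (psd_sqrt g))"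
proof -
  interpret G: prob_space "std_gauss :: (real^('a \<times> 'k)) measure" by (rule prob_space_std_gauss)
  let ?G = "psd_sqrt g"
  have lim_c: "(\<lambda>n. ereal (a n * c - b)) \<longlonglongrightarrow> ereal (- b)" for b c
  proof -
    have "(\<lambda>n. a n * c - b) \<longlonglongrightarrow> 0 * c - b" by (intro tendsto_intros a)
    then show ?thesis by simp
  qed
  have upper: "limsup (\<lambda>n. ereal (1 / (1 / a n)) * eln (measure (\<mu> n) F)) \<le> - (INF z\<in>F. gauss_rate ?G z)"
    if F: "closed F" for F
  proof (rule ccontr)
    let ?J = "INF z\<in>F. gauss_rate ?G z"
    let ?l = "limsup (\<lambda>n. ereal (1 / (1 / a n)) * eln (measure (\<mu> n) F))"
    assume "\<not> ?l \<le> - ?J"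
    \<comment> \<open>A real number in the gap reduces the claim to a bound at the finite level
      \<open>m = - z\<close>, also when the infimum of the rate is infinite.\<close>
    then obtain z where z: "- ?J < ereal z" "ereal z < ?l" using ereal_dense2 by (auto simp: not_le)
    define m where "m = - z"
    have mJ: "ereal m < ?J" using z(1) by (simp add: m_def ereal_uminus_less_reorder)
    have bound: "?l \<le> ereal (- b)" if "K > 0"
      "\<forall>\<^sub>F n in sequentially. measure (\<mu> n) F \<le> K * exp (- b / a n)" for K b
    proof -
      have "\<forall>\<^sub>F n in sequentially. ereal (1 / (1 / a n)) * eln (measure (\<mu> n) F) \<le> ereal (a n * ln K - b)"
        using that(2)
      proof eventually_elim
        case (elim n)
        have "eln (measure (\<mu> n) F) \<le> ereal (ln (K * exp (- b / a n)))"
          using elim that(1) by (intro eln_le) auto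
        also have "ln (K * exp (- b / a n)) = ln K - b / a n" using that(1) by (simp add: ln_mult)
        finally have "ereal (a n) * eln (measure (\<mu> n) F) \<le> ereal (a n) * ereal (ln K - b / a n)"
          using a(1)[of n] by (intro ereal_mult_left_mono) auto
        then show ?case using a(1)[of n] by (simp add: right_diff_distrib)
      qed
      then have "?l \<le> limsup (\<lambda>n. ereal (a n * ln K - b))" by (rule Limsup_mono)
      also have "\<dots> = ereal (- b)" using lim_c by (intro lim_imp_Limsup) auto
      finally show ?thesis .
    qed
    show False
    \<comment> \<open>A negative level contradicts probabilities being at most 1. Otherwise
      \<open>m' > m \<ge> 0\<close> below, so division by \<open>m'\<close> is legitimate.\<close>
    proof (cases "m < 0")
      case True
      have "\<forall>\<^sub>F n in sequentially. measure (\<mu> n) F \<le> 1 * exp (- 0 / a n)"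
        using prob_space.prob_le_1[OF \<mu>(1)] by (intro always_eventually) simp
      from bound[OF _ this] have "?l \<le> ereal 0" by simp
      also have "\<dots> \<le> ereal z" using True by (simp add: m_def)
      finally show False using z(2) by simp
    next
      case False
      obtain m' where m': "ereal m < ereal m'" "ereal m' < ?J" using ereal_dense2[OF mJ] by blast
      \<comment> \<open>The gap between \<open>m\<close> and \<open>m'\<close> pays for the loss in
        the Gaussian tail: at squared radius \<open>2 * m' / a n\<close> the exponent
        \<open>l * R / 2\<close> is exactly \<open>m / a n\<close>.\<close>
      define l where "l = m / m'"
      have l: "0 \<le> l" "l < 1" "l * m' = m" and m'0: "m' > 0" using False m' by (auto simp: l_def)
      obtain K where K: "K > 0"
        "\<And>R. measure std_gauss {x :: real^('a \<times> 'k). R \<le> (norm x)^2} \<le> K * exp (- l * R / 2)"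
        using std_gauss_tail[OF l(1,2)] by blast
      \<comment> \<open>This is the sublevel set at \<open>m'\<close>. It misses \<open>F\<close>
        because \<open>m'\<close> lies below the infimum over \<open>F\<close>, and compactness
        gives a positive distance \<open>d\<close>.\<close>
      let ?K = "mat_act ?G ` cball (0 :: real^('a \<times> 'k)) (sqrt (2 * m'))"
      have cpt: "compact ?K" by (intro compact_continuous_image continuous_on_mat_act compact_cball)
      have "?K \<inter> F = {}"
      proof (rule ccontr)
        assume "?K \<inter> F \<noteq> {}"
        then obtain r where r: "mat_act ?G r \<in> F" "norm r \<le> sqrt (2 * m')" by auto
        then have "gauss_rate ?G (mat_act ?G r) \<le> ereal m'"
          using m'0 by (subst gauss_rate_le_iff) auto
        moreover have "?J \<le> gauss_rate ?G (mat_act ?G r)" using r(1) by (rule INF_lower)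
        ultimately show False using m'(2) by (metis leD order_trans)
      qed
      then obtain d where d: "d > 0" "\<And>y z. y \<in> ?K \<Longrightarrow> z \<in> F \<Longrightarrow> d \<le> dist y z"
        using separate_compact_closed[OF cpt F] by blast
      \<comment> \<open>With this tolerance the maps for \<open>q\<close> and for \<open>g\<close>
        differ by at most \<open>d / 2\<close> on the ball of radius \<open>sqrt (2 * m')\<close>,
        so no point of that ball is sent into \<open>F\<close> by the former.\<close>
      have "d / (2 * sqrt (2 * m')) > 0" using d m'0 by simp
      then obtain \<eta> where \<eta>: "\<eta> > 0" "\<And>q (r :: real^('a \<times> 'k)). sym_psd q \<Longrightarrow> dist q g < \<eta> \<Longrightarrow>
         norm (mat_act (psd_sqrt q) r - mat_act ?G r) \<le> d / (2 * sqrt (2 * m')) * norm r"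
        using mat_act_psd_sqrt_close[OF g] by metis
      obtain C c where c: "c > 0" and ev: "\<forall>\<^sub>F n in sequentially. \<forall>S\<in>sets borel. \<forall>\<beta>.
         (\<forall>q. sym_psd q \<longrightarrow> dist q g < \<eta> \<longrightarrow>
            measure std_gauss {r. sqrt (a n) *\<^sub>R mat_act (psd_sqrt q) r \<in> S} \<le> \<beta>) \<longrightarrow>
         measure (\<mu> n) S \<le> \<beta> + C * exp (- c * v n)" using mix[OF \<eta>(1)] by blast
      have "\<forall>\<^sub>F n in sequentially. measure (\<mu> n) F \<le> (K + 1) * exp (- m / a n)"
        using ev eventually_exp_negligible[OF a av c zero_less_one, of C m]
      proof eventually_elim
        case (elim n)
        have "measure std_gauss {r. sqrt (a n) *\<^sub>R mat_act (psd_sqrt q) r \<in> F} \<le> K * exp (- m / a n)"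
          if q: "sym_psd q" "dist q g < \<eta>" for q
        proof -
          have [measurable]: "{x :: real^('a \<times> 'k). 2 * m' / a n \<le> (norm x)^2} \<in> sets borel" by measurable
          have "{r. sqrt (a n) *\<^sub>R mat_act (psd_sqrt q) r \<in> F} \<subseteq> {x. 2 * m' / a n \<le> (norm x)^2}"
          proof (rule subsetI, rule ccontr)
            fix r assume r: "r \<in> {r. sqrt (a n) *\<^sub>R mat_act (psd_sqrt q) r \<in> F}"
              "r \<notin> {x. 2 * m' / a n \<le> (norm x)^2}"
            let ?y = "sqrt (a n) *\<^sub>R r"
            have "a n * (norm r)^2 \<le> 2 * m'" using r(2) a(1)[of n] by (simp add: field_simps)
            then have "(norm ?y)^2 \<le> 2 * m'" using a(1)[of n] by (simp add: power_mult_distrib)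
            then have y: "norm ?y \<le> sqrt (2 * m')" by (rule real_le_rsqrt)
            then have "d \<le> dist (mat_act ?G ?y) (mat_act (psd_sqrt q) ?y)"
              using r(1) by (intro d(2) imageI) (simp_all add: mat_act.scaleR_right)
            also have "\<dots> \<le> d / (2 * sqrt (2 * m')) * norm ?y"
              using \<eta>(2)[OF q, of ?y] by (simp add: dist_norm norm_minus_commute)
            also have "\<dots> \<le> d / (2 * sqrt (2 * m')) * sqrt (2 * m')"
              using y d m'0 by (intro mult_left_mono) auto
            also have "\<dots> = d / 2" using m'0 by simp
            finally show False using d(1) by simp
          qed
          then have "measure std_gauss {r. sqrt (a n) *\<^sub>R mat_act (psd_sqrt q) r \<in> F}
             \<le> measure std_gauss {x :: real^('a \<times> 'k). 2 * m' / a n \<le> (norm x)^2}"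
            by (intro G.finite_measure_mono) auto
          also have "\<dots> \<le> K * exp (- l * (2 * m' / a n) / 2)" by (rule K(2))
          also have "- l * (2 * m' / a n) / 2 = - m / a n" using l(3) by simp
          finally show ?thesis .
        qed
        then have "measure (\<mu> n) F \<le> K * exp (- m / a n) + C * exp (- c * v n)"
          by (intro elim(1)[THEN bspec, THEN spec, THEN mp] borel_closed[OF F] allI impI)
        then show ?case using elim(2) by (simp add: distrib_right)
      qed
      from bound[OF _ this] K(1) have "?l \<le> ereal z" by (simp add: m_def)
      then show False using z(2) by simp
    qed
  qed
  have lower: "- (INF z\<in>U. gauss_rate ?G z) \<le> liminf (\<lambda>n. ereal (1 / (1 / a n)) * eln (measure (\<mu> n) U))"
    if U: "open U" for U
  proof (rule ccontr)
    let ?l = "liminf (\<lambda>n. ereal (1 / (1 / a n)) * eln (measure (\<mu> n) U))"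
    assume "\<not> - (INF z\<in>U. gauss_rate ?G z) \<le> ?l"
    then obtain b where b: "?l < ereal b" "ereal b < - (INF z\<in>U. gauss_rate ?G z)"
      using ereal_dense2 by (auto simp: not_le)
    have "(INF z\<in>U. gauss_rate ?G z) < ereal (- b)" using b(2) by (metis ereal_less_uminus_reorder uminus_ereal.simps(1))
    then obtain r where r: "mat_act ?G r \<in> U" "norm r ^ 2 / 2 < - b"
      by (auto simp: gauss_rate_def INF_less_iff)
    \<comment> \<open>The slack left by the choice of \<open>r\<close>; with it the Gaussian lower
      bound has exponent exactly \<open>b / a\<close>.\<close>
    define \<epsilon> where "\<epsilon> = - b - norm r ^ 2 / 2"
    have \<epsilon>: "\<epsilon> > 0" "norm r ^ 2 / 2 + \<epsilon> = - b" using r(2) by (auto simp: \<epsilon>_def)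
    obtain d where d: "d > 0" "ball (mat_act ?G r) d \<subseteq> U" using U r(1) openE by blast
    have "\<exists>\<rho>>0. \<forall>y. dist y r < \<rho> \<longrightarrow> dist (mat_act ?G y) (mat_act ?G r) < d / 2"
      using continuous_on_mat_act[of UNIV ?G, unfolded continuous_on_iff] half_gt_zero[OF d(1)] by blast
    then obtain \<rho>' where \<rho>': "\<rho>' > 0" "\<And>y. dist y r < \<rho>' \<Longrightarrow> dist (mat_act ?G y) (mat_act ?G r) < d / 2" by blast
    \<comment> \<open>The cap at 1 keeps points near \<open>r\<close> within norm
      \<open>norm r + 1\<close>, the radius for which \<eta> is chosen.\<close>
    define \<rho> where "\<rho> = min 1 \<rho>'"
    have \<rho>: "\<rho> > 0" "\<rho> \<le> 1" "\<rho> \<le> \<rho>'" using \<rho>' by (auto simp: \<rho>_def)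
    obtain K where K: "K > 0" "\<And>a. 0 < a \<Longrightarrow> a \<le> 1 \<Longrightarrow>
       K * exp (- ((norm r)^2 / 2 + \<epsilon>) / a) \<le> measure std_gauss {x. norm (sqrt a *\<^sub>R x - r) < \<rho>}"
      using std_gauss_ball_lower[OF \<rho>(1) \<epsilon>(1)] by blast
    have r1: "norm r + 1 > 0" using norm_ge_zero[of r] by linarith
    then have "d / (2 * (norm r + 1)) > 0" using d by simp
    then obtain \<eta> where \<eta>: "\<eta> > 0" "\<And>q (r' :: real^('a \<times> 'k)). sym_psd q \<Longrightarrow> dist q g < \<eta> \<Longrightarrow>
       norm (mat_act (psd_sqrt q) r' - mat_act ?G r') \<le> d / (2 * (norm r + 1)) * norm r'"
      using mat_act_psd_sqrt_close[OF g] by metis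
    obtain C c where c: "c > 0" and ev: "\<forall>\<^sub>F n in sequentially. \<forall>S\<in>sets borel. \<forall>\<beta>.
       (\<forall>q. sym_psd q \<longrightarrow> dist q g < \<eta> \<longrightarrow>
          measure std_gauss {r. sqrt (a n) *\<^sub>R mat_act (psd_sqrt q) r \<in> S} \<le> \<beta>) \<longrightarrow>
       measure (\<mu> n) S \<le> \<beta> + C * exp (- c * v n)" using mix[OF \<eta>(1)] by blast
    \<comment> \<open>Half of the Gaussian lower bound is reserved to absorb the error term
      \<open>C * exp (- c * v n)\<close>.\<close>
    have K2: "K / 2 > 0" using K by simp
    have "\<forall>\<^sub>F n in sequentially. a n < 1" using a(2) by (rule order_tendstoD) simp
    with ev eventually_exp_negligible[OF a av c K2, of C "- b"]
    have "\<forall>\<^sub>F n in sequentially. ereal (a n * ln (K / 2) - (- b)) \<le> ereal (1 / (1 / a n)) * eln (measure (\<mu> n) U)"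
    proof eventually_elim
      case (elim n)
      interpret \<mu>: prob_space "\<mu> n" by (rule \<mu>)
      have sp: "space (\<mu> n) = UNIV" using sets_eq_imp_space_eq[OF \<mu>(2)] by simp
      have Ub[measurable]: "U \<in> sets borel" using U by simp
      have m1: "measure std_gauss {r'. sqrt (a n) *\<^sub>R mat_act (psd_sqrt q) r' \<in> - U} \<le> 1 - K * exp (b / a n)"
        if q: "sym_psd q" "dist q g < \<eta>" for q
      proof -
        have [measurable]: "{x :: real^('a \<times> 'k). norm (sqrt (a n) *\<^sub>R x - r) < \<rho>} \<in> sets borel" by measurable
        have "{r'. sqrt (a n) *\<^sub>R mat_act (psd_sqrt q) r' \<in> - U} \<subseteq> - {x. norm (sqrt (a n) *\<^sub>R x - r) < \<rho>}"
        proof clarsimp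
          fix x assume x: "norm (sqrt (a n) *\<^sub>R x - r) < \<rho>"
            and xU: "sqrt (a n) *\<^sub>R mat_act (psd_sqrt q) x \<notin> U"
          let ?y = "sqrt (a n) *\<^sub>R x"
          have "norm ?y \<le> norm r + 1"
            using norm_triangle_ineq2[of ?y r] x \<rho>(2) by linarith
          then have "d / (2 * (norm r + 1)) * norm ?y \<le> d / (2 * (norm r + 1)) * (norm r + 1)"
            using d(1) r1 by (intro mult_left_mono) auto
          also have "d / (2 * R) * R = d / 2" if "R > 0" for R using that by simp
          from this[OF r1] have "d / (2 * (norm r + 1)) * (norm r + 1) = d / 2" .
          finally have "dist (mat_act (psd_sqrt q) ?y) (mat_act ?G ?y) \<le> d / 2"
            using \<eta>(2)[OF q, of ?y] unfolding dist_norm by linarith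
          moreover have "dist (mat_act ?G ?y) (mat_act ?G r) < d / 2"
            using x \<rho>(3) by (intro \<rho>'(2)) (simp add: dist_norm)
          ultimately have "dist (mat_act ?G r) (mat_act (psd_sqrt q) ?y) < d"
            using dist_triangle[of "mat_act (psd_sqrt q) ?y" "mat_act ?G r" "mat_act ?G ?y"]
            by (simp add: dist_commute)
          then show False using d(2) xU by (auto simp: mat_act.scaleR_right)
        qed
        then have "measure std_gauss {r'. sqrt (a n) *\<^sub>R mat_act (psd_sqrt q) r' \<in> - U}
          \<le> measure std_gauss (space std_gauss - {x. norm (sqrt (a n) *\<^sub>R x - r) < \<rho>})"
          by (intro G.finite_measure_mono) (auto simp: Compl_eq_Diff_UNIV)
        also have "\<dots> = 1 - measure std_gauss {x. norm (sqrt (a n) *\<^sub>R x - r) < \<rho>}"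
          by (rule G.prob_compl) simp
        also have "\<dots> \<le> 1 - K * exp (b / a n)"
          using K(2)[of "a n"] a(1)[of n] elim(3) by (simp add: \<epsilon>(2))
        finally show ?thesis .
      qed
      have "- U \<in> sets borel" by simp
      then have "measure (\<mu> n) (- U) \<le> 1 - K * exp (b / a n) + C * exp (- c * v n)"
        using m1 by (intro elim(1)[THEN bspec, THEN spec, THEN mp] allI impI)
      moreover have "measure (\<mu> n) (- U) = 1 - measure (\<mu> n) U"
        using \<mu>.prob_compl[of U] Ub by (simp add: sp \<mu>(2) Compl_eq_Diff_UNIV del: Ub)
      ultimately have "K / 2 * exp (b / a n) \<le> measure (\<mu> n) U"
        using elim(2) by simp
      then have "ereal (ln (K / 2 * exp (b / a n))) \<le> eln (measure (\<mu> n) U)"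
        using K by (intro le_eln) auto
      also have "ln (K / 2 * exp (b / a n)) = ln (K / 2) + b / a n" using K by (subst ln_mult) auto
      finally have "ereal (a n) * ereal (ln (K / 2) + b / a n) \<le> ereal (a n) * eln (measure (\<mu> n) U)"
        using a(1)[of n] by (intro ereal_mult_left_mono) auto
      then show ?case using a(1)[of n] by (simp add: distrib_left)
    qed
    then have "liminf (\<lambda>n. ereal (a n * ln (K / 2) - (- b))) \<le> ?l" by (rule Liminf_mono)
    moreover have "liminf (\<lambda>n. ereal (a n * ln (K / 2) - (- b))) = ereal (- (- b))"
      using lim_c[of "ln (K / 2)" "- b"] by (intro lim_imp_Liminf) auto
    ultimately show False using b(1) by simp
  qed
  show ?thesis unfolding LDP_def using upper lower by auto
qed

section \<open>Gaussian networks\<close>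

lemma norm_matrix_le_sum:
  fixes A :: "real^'n^'m"
  shows "norm A \<le> (\<Sum>i\<in>UNIV. \<Sum>j\<in>UNIV. \<bar>A $ i $ j\<bar>)"
proof -
  have "norm A \<le> (\<Sum>i\<in>UNIV. norm (A $ i))" by (simp add: norm_vec_def L2_set_le_sum)
  also have "\<dots> \<le> (\<Sum>i\<in>UNIV. \<Sum>j\<in>UNIV. \<bar>A $ i $ j\<bar>)" by (intro sum_mono norm_le_l1_cart)
  finally show ?thesis .
qed

lemma norm_matrix_ge_entry:
  fixes A :: "real^'n^'m"
  assumes "norm A \<ge> \<delta>"
  obtains i j where "\<bar>A $ i $ j\<bar> \<ge> \<delta> / (CARD('m) * CARD('n))"
proof (rule ccontr)
  assume "\<not> thesis"
  then have *: "\<bar>A $ i $ j\<bar> < \<delta> / (CARD('m) * CARD('n))" for i j using that by (meson not_le)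
  have "norm A \<le> (\<Sum>i\<in>(UNIV::'m set). \<Sum>j\<in>(UNIV::'n set). \<bar>A $ i $ j\<bar>)" by (rule norm_matrix_le_sum)
  also have "\<dots> < (\<Sum>i\<in>(UNIV::'m set). \<Sum>j\<in>(UNIV::'n set). \<delta> / (CARD('m) * CARD('n)))"
    by (intro sum_strict_mono *) auto
  also have "\<dots> = \<delta>" by simp
  finally show False using assms by simp
qed

text \<open>A single network of fixed widths, so that every constant proved here is explicit in the
  widths, \<open>CW\<close>, \<open>B\<close> and the number of inputs, hence uniform along the
  sequence.\<close>

locale gaussian_network = prob_space M for M :: "'w measure" +
  fixes \<theta> :: "param \<Rightarrow> 'w \<Rightarrow> real" and L :: nat and w :: "nat \<Rightarrow> nat" and Cb CW B :: real
    and sg :: "real \<Rightarrow> real" and x :: "'a::finite \<Rightarrow> nat \<Rightarrow> real"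
  assumes indep: "indep_vars (\<lambda>_. borel) \<theta> (params L w)"
    and gauss: "\<And>p. p \<in> params L w \<Longrightarrow> distr M borel (\<theta> p) = centered_normal (param_var Cb CW w p)"
    and Cb: "0 \<le> Cb" and CW: "0 < CW"
    and sg_cont: "continuous_on UNIV sg" and B: "0 < B" and sg_bd: "\<And>u. \<bar>sg u\<bar> \<le> B"
begin

abbreviation "param_space I \<equiv> PiM I (\<lambda>_::param. borel :: real measure)"

abbreviation "cov \<xi> l \<equiv> emp_cov Cb CW \<xi> w sg x l"

text \<open>Conditioning on the lower layers made concrete: their parameters are frozen at \<xi>,
  while layer \<open>Suc l\<close> stays random.\<close>

definition "split_params l \<xi> \<omega> =
  merge (lower_params w l) (layer_params w (Suc l)) (\<xi>, \<lambda>p\<in>layer_params w (Suc l). \<theta> p \<omega>)"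

lemmas sg_measurable' [measurable] = sg_measurable[OF sg_cont sg_bd]

section \<open>Conditioning on the lower layers\<close>

lemma lower_params_subset: "l \<le> Suc L \<Longrightarrow> lower_params w l \<subseteq> params L w"
  using lower_params_mono by (simp add: params_eq_lower_params)

lemma layer_params_subset: "l \<le> L \<Longrightarrow> layer_params w (Suc l) \<subseteq> params L w"
  using lower_params_subset[of "Suc l"] by (simp add: lower_params_Suc)

lemma \<theta>_measurable: "p \<in> params L w \<Longrightarrow> \<theta> p \<in> borel_measurable M"
  using indep by (auto simp: indep_vars_def)

lemma cov_measurable [measurable]: "(\<lambda>\<xi>. cov \<xi> l) \<in> borel_measurable (param_space (lower_params w l))"
  by (rule emp_cov_measurable) auto

lemma layer_bound:
  assumes l: "l \<le> L"
    and G: "{\<xi> \<in> space (param_space (lower_params w l)). G \<xi>} \<in> sets (param_space (lower_params w l))"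
    and E: "{\<xi> \<in> space (param_space (lower_params w (Suc l))). E \<xi>} \<in> sets (param_space (lower_params w (Suc l)))"
    and \<beta>: "0 \<le> \<beta>"
    and sec: "\<And>\<xi>. G \<xi> \<Longrightarrow> prob {\<omega> \<in> space M. E (split_params l \<xi> \<omega>)} \<le> \<beta>"
  shows "prob {\<omega> \<in> space M. E (\<lambda>p\<in>lower_params w (Suc l). \<theta> p \<omega>)} \<le>
    \<beta> + prob {\<omega> \<in> space M. \<not> G (\<lambda>p\<in>lower_params w l. \<theta> p \<omega>)}"
proof -
  let ?I = "lower_params w l" and ?J = "layer_params w (Suc l)"
  have IJ: "?I \<inter> ?J = {}" by (rule lower_layer_disjoint)
  have ind: "indep_var (param_space ?I) (\<lambda>\<omega>. \<lambda>p\<in>?I. \<theta> p \<omega>) (param_space ?J) (\<lambda>\<omega>. \<lambda>p\<in>?J. \<theta> p \<omega>)"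
    using l by (intro indep_var_restrict[OF indep IJ] lower_params_subset layer_params_subset) auto
  define H where "H = {z \<in> space (param_space ?I \<Otimes>\<^sub>M param_space ?J). E (merge ?I ?J z)}"
  have mg: "merge ?I ?J \<in> measurable (param_space ?I \<Otimes>\<^sub>M param_space ?J) (param_space (lower_params w (Suc l)))"
    unfolding lower_params_Suc by (rule measurable_merge)
  have H: "H \<in> sets (param_space ?I \<Otimes>\<^sub>M param_space ?J)"
  proof -
    have "H = merge ?I ?J -` {\<xi> \<in> space (param_space (lower_params w (Suc l))). E \<xi>} \<inter> space (param_space ?I \<Otimes>\<^sub>M param_space ?J)"
      using measurable_space[OF mg] by (auto simp: H_def)
    then show ?thesis using measurable_sets[OF mg E] by simp
  qed
  have sp: "(\<lambda>p\<in>K. \<theta> p \<omega>) \<in> space (param_space K)" for K \<omega> by (simp add: space_PiM)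
  have "prob {\<omega> \<in> space M. ((\<lambda>p\<in>?I. \<theta> p \<omega>), (\<lambda>p\<in>?J. \<theta> p \<omega>)) \<in> H} \<le>
     \<beta> + prob {\<omega> \<in> space M. (\<lambda>p\<in>?I. \<theta> p \<omega>) \<notin> {\<xi> \<in> space (param_space ?I). G \<xi>}}"
  proof (rule prob_le_section_bound[OF ind G H \<beta>])
    fix \<xi> assume "\<xi> \<in> {\<xi> \<in> space (param_space ?I). G \<xi>}"
    then show "prob {\<omega> \<in> space M. (\<xi>, \<lambda>p\<in>?J. \<theta> p \<omega>) \<in> H} \<le> \<beta>"
      using sec[of \<xi>] sp[of _ ?J] by (simp add: H_def space_pair_measure split_params_def)
  qed
  moreover have "merge ?I ?J ((\<lambda>p\<in>?I. \<theta> p \<omega>), (\<lambda>p\<in>?J. \<theta> p \<omega>)) = (\<lambda>p\<in>lower_params w (Suc l). \<theta> p \<omega>)" for \<omega>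
    by (auto simp: merge_def lower_params_Suc fun_eq_iff)
  ultimately show ?thesis by (simp add: H_def sp space_pair_measure)
qed

lemma preact_split_params:
  assumes "i < w (Suc l)"
  shows "preact (split_params l \<xi> \<omega>) w sg (x a) (Suc l) i =
    \<theta> (Bias (Suc l) i) \<omega> + (\<Sum>j<w l. \<theta> (Weight (Suc l) i j) \<omega> * feat \<xi> w sg x l a j)"
proof -
  have new: "split_params l \<xi> \<omega> p = \<theta> p \<omega>" if "p \<in> layer_params w (Suc l)" for p
    using that lower_layer_disjoint[of w l] by (auto simp: split_params_def merge_def)
  have old: "feat (split_params l \<xi> \<omega>) w sg x l a j = feat \<xi> w sg x l a j" if "j < w l" for j
    by (rule feat_cong) (use that in \<open>auto simp: split_params_def merge_def\<close>)
  show ?thesis unfolding preact_Suc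
    using assms by (simp add: new old Bias_in_layer_params Weight_in_layer_params)
qed

lemma cov_split_params_measurable:
  assumes "l \<le> L"
  shows "(\<lambda>\<omega>. cov (split_params l \<xi> \<omega>) (Suc l)) \<in> borel_measurable M"
proof (rule emp_cov_measurable[OF _ sg_measurable'])
  fix p assume p: "p \<in> lower_params w (Suc l)"
  show "(\<lambda>\<omega>. split_params l \<xi> \<omega> p) \<in> borel_measurable M"
  proof (cases "p \<in> lower_params w l")
    case True
    then show ?thesis by (simp add: split_params_def merge_def)
  next
    case False
    then have "p \<in> layer_params w (Suc l)" using p by (simp add: lower_params_Suc)
    then show ?thesis
      using False \<theta>_measurable[of p] layer_params_subset[OF assms] by (auto simp: split_params_def merge_def)
  qed
qed

text \<open>With \<xi> frozen, layer \<open>Suc l\<close> is linear in fresh independent normals.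
  Distinct neurons use disjoint parameters, whence the zero covariances. A general index type serves
  both one neuron at all inputs and the whole output.\<close>

lemma layer_law:
  fixes h :: "'i::finite \<Rightarrow> nat" and \<alpha> :: "'i \<Rightarrow> 'a" and T :: "real^'i^'i"
  assumes l: "l \<le> L" and h: "\<And>p. h p < w (Suc l)"
    and T: "\<And>p p'. (T ** transpose T) $ p $ p' = (if h p = h p' then cov \<xi> l $ \<alpha> p $ \<alpha> p' else 0)"
  shows "distr M borel (\<lambda>\<omega>. \<chi> p. preact (split_params l \<xi> \<omega>) w sg (x (\<alpha> p)) (Suc l) (h p))
    = distr std_gauss borel (\<lambda>r. T *v r)"
proof -
  let ?J = "layer_params w (Suc l)" and ?f = "feat \<xi> w sg x l"
  \<comment> \<open>The coefficient with which parameter \<open>q\<close> enters component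
    \<open>p\<close>.\<close>
  define u where "u p q = (case q of Bias k i \<Rightarrow> if i = h p then 1 else 0
      | Weight k i j \<Rightarrow> if i = h p then ?f (\<alpha> p) j else 0)" for p q
  have pick: "(\<Sum>i<w (Suc l). if i = h p then F i else 0) = F (h p)" for F :: "nat \<Rightarrow> real" and p
    using h[of p] by (simp add: sum.delta)
  have "preact (split_params l \<xi> \<omega>) w sg (x (\<alpha> p)) (Suc l) (h p) = (\<Sum>q\<in>?J. u p q * \<theta> q \<omega>)" for \<omega> p
  proof -
    have "(\<Sum>q\<in>?J. u p q * \<theta> q \<omega>) = (\<Sum>i<w (Suc l). if i = h p then
        \<theta> (Bias (Suc l) i) \<omega> + (\<Sum>j<w l. \<theta> (Weight (Suc l) i j) \<omega> * ?f (\<alpha> p) j) else 0)"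
      unfolding sum_layer_params by (intro sum.cong refl) (auto simp: u_def mult_ac)
    then show ?thesis using h[of p] by (simp add: pick preact_split_params)
  qed
  moreover have "distr M borel (\<lambda>\<omega>. \<chi> p. \<Sum>q\<in>?J. u p q * \<theta> q \<omega>) = distr std_gauss borel (\<lambda>r. T *v r)"
  proof (rule distr_normal_sum_eq_std_gauss[where v="param_var Cb CW w"])
    show "finite ?J" by (rule finite_layer_params)
    show "indep_vars (\<lambda>_. borel) \<theta> ?J" using indep layer_params_subset[OF l] by (rule indep_vars_subset)
    show "distr M borel (\<theta> q) = centered_normal (param_var Cb CW w q)" if "q \<in> ?J" for q
      using that layer_params_subset[OF l] by (intro gauss) auto
    show "0 \<le> param_var Cb CW w q" for q using Cb CW by (simp add: param_var_def split: param.split)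
    fix p p'
    have "(\<Sum>q\<in>?J. param_var Cb CW w q * u p q * u p' q) = (\<Sum>i<w (Suc l). if i = h p then
        (if h p = h p' then Cb + (\<Sum>j<w l. CW / real (w l) * (?f (\<alpha> p) j * ?f (\<alpha> p') j)) else 0) else 0)"
      unfolding sum_layer_params by (intro sum.cong refl) (auto simp: u_def param_var_def mult.assoc)
    also have "\<dots> = (if h p = h p' then cov \<xi> l $ \<alpha> p $ \<alpha> p' else 0)"
      unfolding pick emp_cov_def by (simp add: sum_distrib_left mult.assoc)
    finally show "(\<Sum>q\<in>?J. param_var Cb CW w q * u p q * u p' q) = (T ** transpose T) $ p $ p'"
      by (simp add: T)
  qed
  ultimately show ?thesis by simp
qed

section \<open>Concentration of one layer given the previous ones\<close>

lemma sym_psd_cov: "sym_psd (cov \<xi> l)"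
  using Cb CW by (simp add: sym_psd_emp_cov)

text \<open>Given \<xi>, the neurons of layer \<open>Suc l\<close> are independent with a common
  law, so the entry is, up to an affine map, an average of independent products with values between
  \<open>- B\<^sup>2\<close> and \<open>B\<^sup>2\<close>. Their mean is the entry of
  \<open>y_mat\<close>, and Hoeffding's inequality applies.\<close>

lemma feature_product_deviation:
  assumes l: "l \<le> L" and n: "w (Suc l) \<ge> 1" and t: "t > 0"
  shows "prob {\<omega> \<in> space M. t \<le> \<bar>(cov (split_params l \<xi> \<omega>) (Suc l) - next_cov Cb CW sg (cov \<xi> l)) $ a $ b\<bar>}
    \<le> 2 * exp (- (t\<^sup>2 / (2 * CW\<^sup>2 * B^4)) * real (w (Suc l)))"
proof -
  let ?n = "w (Suc l)" and ?q = "cov \<xi> l"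
  define V where "V i \<omega> = (\<chi> a. preact (split_params l \<xi> \<omega>) w sg (x a) (Suc l) i)" for i \<omega>
  define X where "X i \<omega> = sg (V i \<omega> $ a) * sg (V i \<omega> $ b)" for i \<omega>
  define Z where "Z i c th = th (Bias (Suc l) i) + (\<Sum>j<w l. th (Weight (Suc l) i j) * feat \<xi> w sg x l c j)"
    for i c and th :: "param \<Rightarrow> real"
  \<comment> \<open>The parameters feeding neuron \<open>i\<close>. These sets are disjoint for
    distinct neurons, which is the source of independence.\<close>
  define K where "K i = insert (Bias (Suc l) i) (Weight (Suc l) i ` {..<w l})" for i
  have V: "V i \<omega> $ c = Z i c (\<lambda>p\<in>K i. \<theta> p \<omega>)" if "i < ?n" for i \<omega> c
    using that by (simp add: V_def Z_def K_def preact_split_params)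
  have Zm[measurable]: "Z i c \<in> borel_measurable (param_space (K i))" for i c
    unfolding Z_def K_def by measurable
  have "indep_vars (\<lambda>i. param_space (K i)) (\<lambda>i \<omega>. \<lambda>p\<in>K i. \<theta> p \<omega>) {..<?n}"
  proof (rule indep_vars_restrict[OF indep])
    show "K i \<subseteq> params L w" if "i \<in> {..<?n}" for i
      using that layer_params_subset[OF l] Bias_in_layer_params[of i w l] Weight_in_layer_params[of i w l]
      by (auto simp: K_def)
    show "disjoint_family_on K {..<?n}" by (auto simp: disjoint_family_on_def K_def)
  qed
  then have "indep_vars (\<lambda>_. borel) (\<lambda>i \<omega>. sg (Z i a (\<lambda>p\<in>K i. \<theta> p \<omega>)) * sg (Z i b (\<lambda>p\<in>K i. \<theta> p \<omega>))) {..<?n}"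
    by (rule indep_vars_compose2) measurable
  then have ind: "indep_vars (\<lambda>_. borel) X {..<?n}"
    by (rule indep_vars_cong[THEN iffD1, rotated -1]) (auto simp: X_def V)
  have XB: "\<bar>X i \<omega>\<bar> \<le> B\<^sup>2" for i \<omega>
    unfolding X_def by (rule abs_sg_mult_le[OF sg_cont sg_bd])
  have EX: "expectation (X i) = y_mat sg ?q $ a $ b" if i: "i < ?n" for i
  proof -
    \<comment> \<open>All components belong to the same neuron \<open>i\<close>, so the covariance
      condition holds with the square root as the factor.\<close>
    have law: "distr M borel (V i) = distr std_gauss borel (\<lambda>r. psd_sqrt ?q *v r)"
      unfolding V_def using i l
      by (intro layer_law) (auto simp: psd_sqrt_mult_transpose[OF sym_psd_cov])
    have [measurable]: "(\<lambda>v. sg (v $ a) * sg (v $ b)) \<in> borel_measurable borel"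
      by measurable
    have [measurable]: "V i \<in> borel_measurable M"
    proof -
      have "\<theta> p \<in> borel_measurable M" if "p \<in> layer_params w (Suc l)" for p
        using that layer_params_subset[OF l] by (intro \<theta>_measurable) auto
      then show ?thesis unfolding V_def using i
        by (intro borel_measurable_vec_lambda)
           (simp add: preact_split_params Bias_in_layer_params Weight_in_layer_params)
    qed
    have [measurable]: "(\<lambda>r. psd_sqrt ?q *v r) \<in> borel_measurable borel"
      by (intro borel_measurable_continuous_onI linear_continuous_on) auto
    have "expectation (X i) = (LINT v|distr M borel (V i). sg (v $ a) * sg (v $ b))"
      by (subst integral_distr) (auto simp: X_def[abs_def])
    also have "\<dots> = y_mat sg ?q $ a $ b"
      unfolding law by (subst integral_distr) (auto simp: y_mat_eq)
    finally show ?thesis .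
  qed
  have n0: "real ?n > 0" using n by simp
  interpret H: Hoeffding_ineq M "{..<?n}" X "\<lambda>_. - B\<^sup>2" "\<lambda>_. B\<^sup>2" "\<Sum>i<?n. expectation (X i)"
    using ind XB by unfold_locales (auto simp: abs_le_iff minus_le_iff)
  \<comment> \<open>The deviation of the unnormalised sum that corresponds to \<open>t\<close> after
    the factor \<open>CW / n\<close>.\<close>
  define s where "s = real ?n * t / CW"
  have s: "s \<ge> 0" using t CW by (simp add: s_def)
  have "prob {\<omega> \<in> space M. \<bar>(\<Sum>i<?n. X i \<omega>) - (\<Sum>i<?n. expectation (X i))\<bar> \<ge> s}
     \<le> 2 * exp (- 2 * s\<^sup>2 / (\<Sum>i<?n. (B\<^sup>2 - - B\<^sup>2)\<^sup>2))"
    using n0 B by (intro H.Hoeffding_ineq_abs_ge s) simp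
  also have "- 2 * s\<^sup>2 / (\<Sum>i<?n. (B\<^sup>2 - - B\<^sup>2)\<^sup>2) = - (t\<^sup>2 / (2 * CW\<^sup>2 * B^4)) * real ?n"
    using n0 B CW by (simp add: s_def power2_eq_square power4_eq_xxxx field_simps)
  also have "{\<omega> \<in> space M. \<bar>(\<Sum>i<?n. X i \<omega>) - (\<Sum>i<?n. expectation (X i))\<bar> \<ge> s} =
     {\<omega> \<in> space M. t \<le> \<bar>(cov (split_params l \<xi> \<omega>) (Suc l) - next_cov Cb CW sg ?q) $ a $ b\<bar>}"
  proof -
    have "\<bar>(\<Sum>i<?n. X i \<omega>) - (\<Sum>i<?n. expectation (X i))\<bar> \<ge> s \<longleftrightarrow>
        t \<le> \<bar>(cov (split_params l \<xi> \<omega>) (Suc l) - next_cov Cb CW sg ?q) $ a $ b\<bar>" for \<omega>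
    proof -
      let ?D = "(\<Sum>i<?n. X i \<omega>) - real ?n * y_mat sg ?q $ a $ b"
      have "(cov (split_params l \<xi> \<omega>) (Suc l) - next_cov Cb CW sg ?q) $ a $ b = CW / real ?n * ?D"
        using n0 by (simp add: emp_cov_def next_cov_def X_def V_def feat_def field_simps)
      then have "\<bar>(cov (split_params l \<xi> \<omega>) (Suc l) - next_cov Cb CW sg ?q) $ a $ b\<bar> = CW / real ?n * \<bar>?D\<bar>"
        using n0 CW by (simp add: abs_mult)
      then have D: "CW * \<bar>?D\<bar> = real ?n * \<bar>(cov (split_params l \<xi> \<omega>) (Suc l) - next_cov Cb CW sg ?q) $ a $ b\<bar>"
        using n0 by simp
      have "s \<le> \<bar>?D\<bar> \<longleftrightarrow> real ?n * t \<le> CW * \<bar>?D\<bar>" using CW by (simp add: s_def field_simps)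
      then have "s \<le> \<bar>?D\<bar> \<longleftrightarrow> t \<le> \<bar>(cov (split_params l \<xi> \<omega>) (Suc l) - next_cov Cb CW sg ?q) $ a $ b\<bar>"
        unfolding D using n0 by (simp only: mult_le_cancel_left_pos)
      moreover have "(\<Sum>i<?n. expectation (X i)) = real ?n * y_mat sg ?q $ a $ b" by (simp add: EX)
      ultimately show ?thesis by simp
    qed
    then show ?thesis by simp
  qed
  finally show ?thesis .
qed

text \<open>Union bound over the entries: if the norm is at least \<open>t\<close>, some entry is at
  least \<open>t\<close> divided by the number of entries.\<close>

lemma cov_deviation:
  assumes l: "l \<le> L" and n: "w (Suc l) \<ge> 1" and t: "t > 0"
  shows "prob {\<omega> \<in> space M. t \<le> dist (cov (split_params l \<xi> \<omega>) (Suc l)) (next_cov Cb CW sg (cov \<xi> l))}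
    \<le> 2 * real CARD('a)^2 * exp (- ((t / real CARD('a)^2)\<^sup>2 / (2 * CW\<^sup>2 * B^4)) * real (w (Suc l)))"
proof -
  let ?D = "\<lambda>\<omega>. cov (split_params l \<xi> \<omega>) (Suc l) - next_cov Cb CW sg (cov \<xi> l)"
  define t' where "t' = t / real CARD('a)^2"
  have t': "t' > 0" using t by (simp add: t'_def)
  let ?e = "exp (- (t'\<^sup>2 / (2 * CW\<^sup>2 * B^4)) * real (w (Suc l)))"
  note [measurable] = cov_split_params_measurable[OF l]
  have "{\<omega> \<in> space M. t \<le> dist (cov (split_params l \<xi> \<omega>) (Suc l)) (next_cov Cb CW sg (cov \<xi> l))} \<subseteq>
     (\<Union>(a, b)\<in>UNIV. {\<omega> \<in> space M. t' \<le> \<bar>?D \<omega> $ a $ b\<bar>})"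
  proof clarify
    fix \<omega> assume \<omega>: "\<omega> \<in> space M" and "t \<le> dist (cov (split_params l \<xi> \<omega>) (Suc l)) (next_cov Cb CW sg (cov \<xi> l))"
    then have "norm (?D \<omega>) \<ge> t" by (simp add: dist_norm)
    from norm_matrix_ge_entry[OF this] obtain a b where "\<bar>?D \<omega> $ a $ b\<bar> \<ge> t / (CARD('a) * CARD('a))"
      by blast
    then show "\<omega> \<in> (\<Union>(a, b)\<in>UNIV. {\<omega> \<in> space M. t' \<le> \<bar>?D \<omega> $ a $ b\<bar>})"
      using \<omega> by (auto simp: t'_def power2_eq_square)
  qed
  moreover have ev: "{\<omega> \<in> space M. t' \<le> \<bar>?D \<omega> $ a $ b\<bar>} \<in> events" for a b
  proof -
    have [measurable]: "(\<lambda>A :: real^'a^'a. A $ a $ b) \<in> borel_measurable borel"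
      by (intro borel_measurable_continuous_onI continuous_intros)
    have "(\<lambda>\<omega>. ?D \<omega> $ a $ b) \<in> borel_measurable M"
      by (rule measurable_compose[of ?D]) measurable
    then show ?thesis by measurable
  qed
  ultimately have "prob {\<omega> \<in> space M. t \<le> dist (cov (split_params l \<xi> \<omega>) (Suc l)) (next_cov Cb CW sg (cov \<xi> l))} \<le>
     prob (\<Union>(a, b)\<in>UNIV. {\<omega> \<in> space M. t' \<le> \<bar>?D \<omega> $ a $ b\<bar>})"
    by (intro finite_measure_mono sets.finite_UN) (auto simp only: finite ev split: prod.split)
  also have "\<dots> \<le> (\<Sum>z\<in>UNIV. prob (case z of (a, b) \<Rightarrow> {\<omega> \<in> space M. t' \<le> \<bar>?D \<omega> $ a $ b\<bar>}))"
    by (intro finite_measure_subadditive_finite) (use ev in \<open>auto simp only: finite split: prod.split\<close>)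
  also have "\<dots> \<le> (\<Sum>z\<in>(UNIV::('a \<times> 'a) set). 2 * ?e)"
  proof (rule sum_mono)
    fix z :: "'a \<times> 'a"
    show "prob (case z of (a, b) \<Rightarrow> {\<omega> \<in> space M. t' \<le> \<bar>?D \<omega> $ a $ b\<bar>}) \<le> 2 * ?e"
      using feature_product_deviation[OF l n t', of \<xi> "fst z" "snd z"] by (simp only: case_prod_unfold)
  qed
  also have "\<dots> = 2 * real CARD('a)^2 * ?e" by (simp add: card_cartesian_product power2_eq_square flip: UNIV_Times_UNIV)
  finally show ?thesis by (simp add: t'_def)
qed

lemma cov_restrict: "cov (\<lambda>p\<in>lower_params w l. \<theta> p \<omega>) l = cov (\<lambda>p. \<theta> p \<omega>) l"
  by (rule emp_cov_cong) simp

text \<open>Half of \<delta> is allotted to the fluctuation of the new layer given the old one, the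
  other half to the error of the old layer pushed through the continuous map
  \<open>next_cov\<close>.\<close>

lemma cov_step:
  assumes l: "l \<le> L" and n: "w (Suc l) \<ge> 1" and \<delta>: "\<delta> > 0"
    and \<eta>: "\<And>q. sym_psd q \<Longrightarrow> dist q g < \<eta> \<Longrightarrow> dist (next_cov Cb CW sg q) (next_cov Cb CW sg g) < \<delta> / 2"
  shows "prob {\<omega> \<in> space M. \<delta> \<le> dist (cov (\<lambda>p. \<theta> p \<omega>) (Suc l)) (next_cov Cb CW sg g)} \<le>
    2 * real CARD('a)^2 * exp (- ((\<delta> / 2 / real CARD('a)^2)\<^sup>2 / (2 * CW\<^sup>2 * B^4)) * real (w (Suc l)))
    + prob {\<omega> \<in> space M. \<eta> \<le> dist (cov (\<lambda>p. \<theta> p \<omega>) l) g}"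
proof -
  have "prob {\<omega> \<in> space M. \<delta> \<le> dist (cov (\<lambda>p\<in>lower_params w (Suc l). \<theta> p \<omega>) (Suc l)) (next_cov Cb CW sg g)} \<le>
    2 * real CARD('a)^2 * exp (- ((\<delta> / 2 / real CARD('a)^2)\<^sup>2 / (2 * CW\<^sup>2 * B^4)) * real (w (Suc l)))
    + prob {\<omega> \<in> space M. \<not> dist (cov (\<lambda>p\<in>lower_params w l. \<theta> p \<omega>) l) g < \<eta>}"
  proof (rule layer_bound[OF l])
    show "{\<xi> \<in> space (param_space (lower_params w l)). dist (cov \<xi> l) g < \<eta>} \<in> sets (param_space (lower_params w l))"
      by measurable
    show "{\<xi> \<in> space (param_space (lower_params w (Suc l))). \<delta> \<le> dist (cov \<xi> (Suc l)) (next_cov Cb CW sg g)}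
      \<in> sets (param_space (lower_params w (Suc l)))"
      by measurable
    fix \<xi> assume "dist (cov \<xi> l) g < \<eta>"
    then have "dist (next_cov Cb CW sg (cov \<xi> l)) (next_cov Cb CW sg g) < \<delta> / 2" by (intro \<eta> sym_psd_cov)
    then have "{\<omega> \<in> space M. \<delta> \<le> dist (cov (split_params l \<xi> \<omega>) (Suc l)) (next_cov Cb CW sg g)} \<subseteq>
      {\<omega> \<in> space M. \<delta> / 2 \<le> dist (cov (split_params l \<xi> \<omega>) (Suc l)) (next_cov Cb CW sg (cov \<xi> l))}"
    proof clarify
      fix \<omega>
      assume "\<delta> \<le> dist (cov (split_params l \<xi> \<omega>) (Suc l)) (next_cov Cb CW sg g)"
        and "dist (next_cov Cb CW sg (cov \<xi> l)) (next_cov Cb CW sg g) < \<delta> / 2"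
      then show "\<delta> / 2 \<le> dist (cov (split_params l \<xi> \<omega>) (Suc l)) (next_cov Cb CW sg (cov \<xi> l))"
        using dist_triangle[of "cov (split_params l \<xi> \<omega>) (Suc l)" "next_cov Cb CW sg g" "next_cov Cb CW sg (cov \<xi> l)"]
        by linarith
    qed
    moreover note [measurable] = cov_split_params_measurable[OF l]
    ultimately have "prob {\<omega> \<in> space M. \<delta> \<le> dist (cov (split_params l \<xi> \<omega>) (Suc l)) (next_cov Cb CW sg g)} \<le>
      prob {\<omega> \<in> space M. \<delta> / 2 \<le> dist (cov (split_params l \<xi> \<omega>) (Suc l)) (next_cov Cb CW sg (cov \<xi> l))}"
      by (intro finite_measure_mono) auto
    also have "\<dots> \<le> 2 * real CARD('a)^2 * exp (- ((\<delta> / 2 / real CARD('a)^2)\<^sup>2 / (2 * CW\<^sup>2 * B^4)) * real (w (Suc l)))"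
      using \<delta> by (intro cov_deviation l n) simp
    finally show "prob {\<omega> \<in> space M. \<delta> \<le> dist (cov (split_params l \<xi> \<omega>) (Suc l)) (next_cov Cb CW sg g)} \<le> \<dots>" .
  qed simp
  then show ?thesis by (simp add: cov_restrict not_less)
qed

section \<open>The law of the output\<close>

definition net_output :: "('k::finite \<Rightarrow> nat) \<Rightarrow> 'w \<Rightarrow> real^('a \<times> 'k)" where
  "net_output idx \<omega> = (\<chi> p. preact (\<lambda>q. \<theta> q \<omega>) w sg (x (fst p)) (Suc L) (idx (snd p)))"

lemma output_measurable:
  assumes "\<And>k. idx k < w (Suc L)"
  shows "net_output idx \<in> borel_measurable M"
proof -
  have [measurable]: "\<theta> p \<in> borel_measurable M" if "p \<in> layer_params w (Suc L)" for p
    using that layer_params_subset[of L] by (intro \<theta>_measurable) auto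
  have [measurable]: "(\<lambda>\<omega>. feat (\<lambda>q. \<theta> q \<omega>) w sg x L a j) \<in> borel_measurable M" if "j < w L" for a j
    using _ that sg_measurable' by (rule feat_measurable) (use lower_params_subset[of L] in \<open>auto intro: \<theta>_measurable\<close>)
  show ?thesis unfolding net_output_def preact_Suc
    using assms by (intro borel_measurable_vec_lambda)
      (simp add: Bias_in_layer_params Weight_in_layer_params)
qed

text \<open>Given the first \<open>L\<close> layers, the output has the law of
  \<open>mat_act (psd_sqrt q)\<close> applied to a standard Gaussian vector, \<open>q\<close> being
  the empirical matrix. The hypothesis bounds this whenever \<open>q\<close> is within \<eta> of
  \<open>g\<close>; the other outcomes are counted in full.\<close>

lemma output_mixture_bound:
  fixes idx :: "'k::finite \<Rightarrow> nat" and S :: "(real^('a \<times> 'k)) set"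
  assumes idx: "\<And>k. idx k < w (Suc L)" "inj idx" and S: "S \<in> sets borel" and \<eta>: "\<eta> > 0" and g: "sym_psd g"
    and \<beta>: "\<And>q. sym_psd q \<Longrightarrow> dist q g < \<eta> \<Longrightarrow> measure std_gauss {r. s *\<^sub>R mat_act (psd_sqrt q) r \<in> S} \<le> \<beta>"
  shows "prob {\<omega> \<in> space M. s *\<^sub>R net_output idx \<omega> \<in> S} \<le> \<beta> + prob {\<omega> \<in> space M. \<eta> \<le> dist (cov (\<lambda>p. \<theta> p \<omega>) L) g}"
proof -
  define out where "out \<xi> = (\<chi> p. preact \<xi> w sg (x (fst p)) (Suc L) (idx (snd p)))" for \<xi>
  have out_restrict: "out (\<lambda>p\<in>lower_params w (Suc L). \<theta> p \<omega>) = net_output idx \<omega>" for \<omega>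
  proof -
    have "feat (\<lambda>p\<in>lower_params w (Suc L). \<theta> p \<omega>) w sg x L a j = feat (\<lambda>p. \<theta> p \<omega>) w sg x L a j" if "j < w L" for a j
      by (rule feat_cong) (use that in \<open>auto simp: lower_params_Suc\<close>)
    then show ?thesis unfolding out_def net_output_def preact_Suc using idx(1)
      by (simp add: vec_eq_iff lower_params_Suc Bias_in_layer_params Weight_in_layer_params)
  qed
  have out_m[measurable]: "out \<in> borel_measurable (param_space (lower_params w (Suc L)))"
  proof -
    have [measurable]: "(\<lambda>\<xi>. \<xi> p) \<in> borel_measurable (param_space (lower_params w (Suc L)))"
      if "p \<in> layer_params w (Suc L)" for p
      using that by (intro measurable_component_singleton) (simp add: lower_params_Suc)
    have [measurable]: "(\<lambda>\<xi>. feat \<xi> w sg x L a j) \<in> borel_measurable (param_space (lower_params w (Suc L)))" if "j < w L" for a j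
      using _ that sg_measurable' by (rule feat_measurable) (auto simp: lower_params_Suc intro: measurable_component_singleton)
    show ?thesis unfolding out_def preact_Suc
      using idx(1) by (intro borel_measurable_vec_lambda)
        (simp add: Bias_in_layer_params Weight_in_layer_params)
  qed
  \<comment> \<open>The choice \<open>q = g\<close> shows that \<beta> dominates a
    probability.\<close>
  have \<beta>0: "0 \<le> \<beta>" using \<beta>[OF g] \<eta> by (auto intro: order_trans[OF measure_nonneg])
  have "prob {\<omega> \<in> space M. s *\<^sub>R out (\<lambda>p\<in>lower_params w (Suc L). \<theta> p \<omega>) \<in> S} \<le>
    \<beta> + prob {\<omega> \<in> space M. \<not> dist (cov (\<lambda>p\<in>lower_params w L. \<theta> p \<omega>) L) g < \<eta>}"
  proof (rule layer_bound[OF order_refl])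
    show "{\<xi> \<in> space (param_space (lower_params w L)). dist (cov \<xi> L) g < \<eta>} \<in> sets (param_space (lower_params w L))"
      by measurable
    show "{\<xi> \<in> space (param_space (lower_params w (Suc L))). s *\<^sub>R out \<xi> \<in> S}
      \<in> sets (param_space (lower_params w (Suc L)))"
      using S by measurable
    fix \<xi> assume near: "dist (cov \<xi> L) g < \<eta>"
    let ?s = "psd_sqrt (cov \<xi> L)"
    \<comment> \<open>Block diagonal with one copy of the square root per output neuron, since
      output neurons are conditionally independent with equal covariance.\<close>
    define T :: "real^('a \<times> 'k)^('a \<times> 'k)" where
      "T = (\<chi> p p'. if snd p = snd p' then ?s $ fst p $ fst p' else 0)"
    have TT: "(T ** transpose T) $ p $ p' = (if idx (snd p) = idx (snd p') then cov \<xi> L $ fst p $ fst p' else 0)" for p p'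
    proof -
      have "(T ** transpose T) $ p $ p' = (\<Sum>c\<in>UNIV. \<Sum>k\<in>UNIV. T $ p $ (c, k) * T $ p' $ (c, k))"
        by (simp add: matrix_matrix_mult_def transpose_def sum.cartesian_product flip: UNIV_Times_UNIV)
      also have "\<dots> = (\<Sum>c\<in>UNIV. \<Sum>k\<in>UNIV. if k = snd p then
          (if snd p = snd p' then ?s $ fst p $ c * ?s $ fst p' $ c else 0) else 0)"
        by (intro sum.cong refl) (auto simp: T_def)
      also have "\<dots> = (if snd p = snd p' then (?s ** transpose ?s) $ fst p $ fst p' else 0)"
        by (simp add: matrix_matrix_mult_def transpose_def)
      finally show ?thesis using idx(2) by (simp add: psd_sqrt_mult_transpose sym_psd_cov inj_eq)
    qed
    have Tr: "T *v r = mat_act ?s r" for r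
    proof -
      have "(T *v r) $ p = mat_act ?s r $ p" for p
      proof -
        have "(T *v r) $ p = (\<Sum>c\<in>UNIV. \<Sum>k\<in>UNIV. T $ p $ (c, k) * r $ (c, k))"
          by (simp add: matrix_vector_mult_def sum.cartesian_product flip: UNIV_Times_UNIV)
        also have "\<dots> = (\<Sum>c\<in>UNIV. \<Sum>k\<in>UNIV. if k = snd p then ?s $ fst p $ c * r $ (c, k) else 0)"
          by (intro sum.cong refl) (auto simp: T_def)
        finally show ?thesis by (simp add: mat_act_def)
      qed
      then show ?thesis by (simp add: vec_eq_iff)
    qed
    have law: "distr M borel (\<lambda>\<omega>. out (split_params L \<xi> \<omega>)) = distr std_gauss borel (\<lambda>r. T *v r)"
      unfolding out_def using idx(1) TT by (intro layer_law[where \<xi>=\<xi>]) auto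
    have [measurable]: "(\<lambda>\<omega>. out (split_params L \<xi> \<omega>)) \<in> borel_measurable M"
    proof -
      have "\<theta> p \<in> borel_measurable M" if "p \<in> layer_params w (Suc L)" for p
        using that layer_params_subset[of L] by (intro \<theta>_measurable) auto
      then show ?thesis unfolding out_def using idx(1)
        by (intro borel_measurable_vec_lambda)
           (simp add: preact_split_params Bias_in_layer_params Weight_in_layer_params)
    qed
    have [measurable]: "(\<lambda>r. T *v r) \<in> borel_measurable borel"
      by (intro borel_measurable_continuous_onI linear_continuous_on) auto
    have S'[measurable]: "{v. s *\<^sub>R v \<in> S} \<in> sets borel"
      using S by measurable
    have "prob {\<omega> \<in> space M. s *\<^sub>R out (split_params L \<xi> \<omega>) \<in> S} =
        measure (distr M borel (\<lambda>\<omega>. out (split_params L \<xi> \<omega>))) {v. s *\<^sub>R v \<in> S}"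
      by (subst measure_distr) (auto intro!: arg_cong2[where f=measure])
    also have "\<dots> = measure std_gauss {r. s *\<^sub>R mat_act ?s r \<in> S}"
      unfolding law by (subst measure_distr) (auto intro!: arg_cong2[where f=measure] simp: Tr)
    also have "\<dots> \<le> \<beta>" using near by (intro \<beta> sym_psd_cov)
    finally show "prob {\<omega> \<in> space M. s *\<^sub>R out (split_params L \<xi> \<omega>) \<in> S} \<le> \<beta>" .
  qed (rule \<beta>0)
  then show ?thesis by (simp add: cov_restrict out_restrict not_less)
qed

end

section \<open>Concentration and the large deviation principle\<close>

text \<open>Induction over the layers. Each step adds one Hoeffding term and shrinks the radius
  demanded of the layer below, but there are finitely many layers, so a positive rate
  survives.\<close>

lemma cov_concentration:
  fixes x :: "'a::finite \<Rightarrow> nat \<Rightarrow> real" and v :: "nat \<Rightarrow> real"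
  assumes net: "\<And>n. gaussian_network (M n) (\<theta> n) L (nw n) Cb CW B sg"
    and w0: "\<And>n. nw n 0 = n0"
    and wpos: "\<And>n l. 1 \<le> l \<Longrightarrow> l \<le> L \<Longrightarrow> nw n l \<ge> 1"
    and v0: "\<And>n. 0 \<le> v n"
    and v: "\<And>l. 1 \<le> l \<Longrightarrow> l \<le> L \<Longrightarrow> \<forall>\<^sub>F n in sequentially. v n / 2 \<le> real (nw n l)"
    and "l \<le> L" "\<delta> > 0"
  shows "\<exists>C c. c > 0 \<and> (\<forall>\<^sub>F n in sequentially. measure (M n) {\<omega> \<in> space (M n).
     \<delta> \<le> dist (emp_cov Cb CW (\<lambda>p. \<theta> n p \<omega>) (nw n) sg x l) (ghat Cb CW sg n0 x l)} \<le> C * exp (- c * v n))"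
  using \<open>l \<le> L\<close> \<open>\<delta> > 0\<close>
proof (induction l arbitrary: \<delta>)
  case 0
  then have empty: "{\<omega> \<in> space (M n). \<delta> \<le> dist (emp_cov Cb CW (\<lambda>p. \<theta> n p \<omega>) (nw n) sg x 0) (ghat Cb CW sg n0 x 0)} = {}" for n
    by (simp add: emp_cov_0 w0)
  \<comment> \<open>The inputs are deterministic, so \<open>C = 0\<close> works with any positive
    rate.\<close>
  show ?case by (rule exI[of _ 0], rule exI[of _ 1]) (simp only: empty measure_empty, simp)
next
  case (Suc l)
  let ?g = "ghat Cb CW sg n0 x" and ?nc = "next_cov Cb CW sg :: real^'a^'a \<Rightarrow> _"
  have par: "0 \<le> Cb" "0 < CW" "continuous_on UNIV sg" "0 < B" "\<And>u. \<bar>sg u\<bar> \<le> B"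
    using net[of 0] by (auto simp: gaussian_network_def gaussian_network_axioms_def)
  have g: "sym_psd (?g l)" using par by (intro sym_psd_ghat) auto
  have "\<delta> / 2 > 0" using Suc.prems by simp
  then obtain \<eta> where \<eta>: "\<eta> > 0" "\<And>q. sym_psd q \<Longrightarrow> dist q (?g l) < \<eta> \<Longrightarrow> dist (?nc q) (?nc (?g l)) < \<delta> / 2"
    using continuous_on_next_cov[OF par(3,5), of Cb CW, unfolded continuous_on_iff] g by (metis mem_Collect_eq)
  obtain C c where c: "c > 0" and IH: "\<forall>\<^sub>F n in sequentially. measure (M n) {\<omega> \<in> space (M n).
     \<eta> \<le> dist (emp_cov Cb CW (\<lambda>p. \<theta> n p \<omega>) (nw n) sg x l) (?g l)} \<le> C * exp (- c * v n)"
    using Suc.IH[OF _ \<eta>(1)] Suc.prems(1) by auto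
  define \<kappa> where "\<kappa> = (\<delta> / 2 / real CARD('a)^2)\<^sup>2 / (2 * CW\<^sup>2 * B^4)"
  have \<kappa>: "\<kappa> > 0" using par Suc.prems(2) by (simp add: \<kappa>_def)
  \<comment> \<open>The factor 1/2 comes from the widths being known only to exceed
    \<open>v n / 2\<close>.\<close>
  define c' where "c' = min c (\<kappa> / 2)"
  have c': "c' > 0" "c' \<le> c" "c' \<le> \<kappa> / 2" using c \<kappa> by (auto simp: c'_def)
  have "\<forall>\<^sub>F n in sequentially. v n / 2 \<le> real (nw n (Suc l))" using v Suc.prems(1) by simp
  with IH have "\<forall>\<^sub>F n in sequentially. measure (M n) {\<omega> \<in> space (M n).
     \<delta> \<le> dist (emp_cov Cb CW (\<lambda>p. \<theta> n p \<omega>) (nw n) sg x (Suc l)) (?g (Suc l))}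
     \<le> (2 * real CARD('a)^2 + \<bar>C\<bar>) * exp (- c' * v n)"
  proof eventually_elim
    case (elim n)
    interpret gaussian_network "M n" "\<theta> n" L "nw n" Cb CW B sg x by (rule net)
    have "c' * v n \<le> \<kappa> / 2 * v n" using c' v0[of n] by (intro mult_right_mono) auto
    also have "\<dots> = \<kappa> * (v n / 2)" by simp
    also have "\<dots> \<le> \<kappa> * real (nw n (Suc l))" using elim(2) \<kappa> by (intro mult_left_mono) auto
    finally have 1: "exp (- \<kappa> * real (nw n (Suc l))) \<le> exp (- c' * v n)" by simp
    have "C * exp (- c * v n) \<le> \<bar>C\<bar> * exp (- c' * v n)"
      using c' v0[of n] by (intro mult_mono) (auto intro: mult_right_mono)
    moreover have "2 * real CARD('a)^2 * exp (- \<kappa> * real (nw n (Suc l))) \<le> 2 * real CARD('a)^2 * exp (- c' * v n)"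
      using 1 by (intro mult_left_mono) auto
    moreover have "prob {\<omega> \<in> space (M n). \<delta> \<le> dist (cov (\<lambda>p. \<theta> n p \<omega>) (Suc l)) (?nc (?g l))} \<le>
      2 * real CARD('a)^2 * exp (- \<kappa> * real (nw n (Suc l)))
      + prob {\<omega> \<in> space (M n). \<eta> \<le> dist (cov (\<lambda>p. \<theta> n p \<omega>) l) (?g l)}"
      unfolding \<kappa>_def using Suc.prems wpos[of "Suc l" n] \<eta>(2) by (intro cov_step) auto
    ultimately show ?case using elim(1) by (simp only: ghat_Suc distrib_right)
  qed
  then show ?case using c'(1) by blast
qed

theorem theorem2p2:
  fixes L n0 :: nat and Cb CW :: real and sg :: "real \<Rightarrow> real"
    and nw :: "nat \<Rightarrow> nat \<Rightarrow> nat"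
    and x :: "'a::finite \<Rightarrow> nat \<Rightarrow> real"
    and idx :: "'k::finite \<Rightarrow> nat"
    and M :: "nat \<Rightarrow> 'w measure" and \<theta> :: "nat \<Rightarrow> param \<Rightarrow> 'w \<Rightarrow> real"
    and lhat :: nat
  assumes L: "L \<ge> 1" and n0: "n0 \<ge> 1" and Cb: "Cb \<ge> 0" and CW: "CW > 0"
    and w0: "\<And>n. nw n 0 = n0"
    and wout: "\<And>n. nw n (Suc L) = CARD('k)"
    and idx: "bij_betw idx UNIV {..<CARD('k)}"
    and wpos: "\<And>n l. 1 \<le> l \<Longrightarrow> l \<le> L \<Longrightarrow> nw n l \<ge> 1"
    and winf: "\<And>l. 1 \<le> l \<Longrightarrow> l \<le> L \<Longrightarrow> filterlim (\<lambda>n. nw n l) at_top sequentially"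
    and prob: "\<And>n. prob_space (M n)"
    and indep: "\<And>n. prob_space.indep_vars (M n) (\<lambda>_. borel) (\<theta> n) (params L (nw n))"
    and gauss: "\<And>n p. p \<in> params L (nw n) \<Longrightarrow>
                  distr (M n) borel (\<theta> n p) = centered_normal (param_var Cb CW (nw n) p)"
    and sg_cont: "continuous_on UNIV sg" and sg_bdd: "bounded (range sg)"
    and lhat: "1 \<le> lhat" "lhat \<le> L"
    and ratio: "\<And>l. 1 \<le> l \<Longrightarrow> l \<le> L \<Longrightarrow> \<exists>\<gamma>::ereal. \<gamma> \<ge> 1 \<and>
                  ((\<lambda>n. ereal (real (nw n l) / real (nw n lhat))) \<longlongrightarrow> \<gamma>) sequentially"
  shows "\<forall>a :: nat \<Rightarrow> real. (\<forall>n. a n > 0) \<and> (a \<longlonglongrightarrow> 0) \<and>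
            filterlim (\<lambda>n. a n * real (nw n lhat)) at_top sequentially \<longrightarrow>
          (let G = psd_sqrt (ghat Cb CW sg n0 x L);
               I = (\<lambda>z::real^('a \<times> 'k). INF r \<in> {r. mat_act G r = z}. ereal (norm r ^ 2 / 2))
           in LDP (\<lambda>n. distr (M n) borel
                     (\<lambda>\<omega>. \<chi> p. sqrt (a n) *
                        preact (\<lambda>q. \<theta> n q \<omega>) (nw n) sg (x (fst p)) (Suc L) (idx (snd p))))
                  (\<lambda>n. 1 / a n) I
              \<and> good_rate_function I
              \<and> (invertible (ghat Cb CW sg n0 x L) \<longrightarrow>
                   (\<forall>z. I z = ereal (norm (mat_act (matrix_inv G) z) ^ 2 / 2))))"
proof (intro allI impI, elim conjE)
  fix a :: "nat \<Rightarrow> real"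
  assume "\<forall>n. a n > 0" and a0: "a \<longlonglongrightarrow> 0"
    and av: "filterlim (\<lambda>n. a n * real (nw n lhat)) at_top sequentially"
  then have a: "a n > 0" for n by blast
  obtain B where B: "0 < B" "\<And>u. \<bar>sg u\<bar> \<le> B"
    using sg_bdd by (auto simp: bounded_pos)
  have net: "gaussian_network (M n) (\<theta> n) L (nw n) Cb CW B sg" for n
    unfolding gaussian_network_def gaussian_network_axioms_def
    using prob indep gauss Cb CW sg_cont B by blast
  let ?g = "ghat Cb CW sg n0 x L"
  let ?v = "\<lambda>n. real (nw n lhat)"
  let ?\<mu> = "\<lambda>n. distr (M n) borel (\<lambda>\<omega>. \<chi> p. sqrt (a n) *
      preact (\<lambda>q. \<theta> n q \<omega>) (nw n) sg (x (fst p)) (Suc L) (idx (snd p))) :: (real^('a \<times> 'k)) measure"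
  have g: "sym_psd ?g" using CW by (intro sym_psd_ghat[OF sg_cont B(2) Cb]) simp
  \<comment> \<open>Any constant below 1 could stand in for 1/2: a strict lower bound on the limit
    holds eventually along the sequence. The limit is taken in \<open>ereal\<close>, so \<gamma> =
    \<infinity> is included.\<close>
  have half: "\<forall>\<^sub>F n in sequentially. ?v n / 2 \<le> real (nw n l)" if l: "1 \<le> l" "l \<le> L" for l
  proof -
    obtain \<gamma> :: ereal where "\<gamma> \<ge> 1" and lim: "((\<lambda>n. ereal (real (nw n l) / ?v n)) \<longlongrightarrow> \<gamma>) sequentially"
      using ratio[OF l] by blast
    then have "ereal (1 / 2) < \<gamma>" by (intro less_le_trans[OF _ \<open>\<gamma> \<ge> 1\<close>]) (simp add: one_ereal_def)
    from order_tendstoD(1)[OF lim this] show ?thesis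
    proof eventually_elim
      case (elim n)
      then show ?case using wpos[OF lhat, of n] by (simp add: field_simps)
    qed
  qed
  have idx': "inj idx" "idx k < nw n (Suc L)" for k n
    using idx by (auto simp: bij_betw_def wout)
  have out: "(\<lambda>\<omega>. \<chi> p. sqrt (a n) * preact (\<lambda>q. \<theta> n q \<omega>) (nw n) sg (x (fst p)) (Suc L) (idx (snd p))) =
      (\<lambda>\<omega>. sqrt (a n) *\<^sub>R gaussian_network.net_output (\<theta> n) L (nw n) sg x idx \<omega>)" for n
    by (simp add: gaussian_network.net_output_def[OF net] vec_eq_iff fun_eq_iff del: preact.simps)
  have out_m: "(\<lambda>\<omega>. sqrt (a n) *\<^sub>R gaussian_network.net_output (\<theta> n) L (nw n) sg x idx \<omega>)
      \<in> borel_measurable (M n)" for n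
    by (intro borel_measurable_scaleR borel_measurable_const
        gaussian_network.output_measurable[OF net] idx'(2))
  have ldp: "LDP ?\<mu> (\<lambda>n. 1 / a n) (gauss_rate (psd_sqrt ?g))"
  proof (rule LDP_gaussian_mixture[OF g _ _ a a0 av])
    show "prob_space (?\<mu> n)" for n
      unfolding out using out_m by (intro prob_space.prob_space_distr prob)
    show "sets (?\<mu> n) = sets borel" for n by simp
    fix \<eta> :: real assume \<eta>: "\<eta> > 0"
    obtain C c where c: "c > 0" and ev: "\<forall>\<^sub>F n in sequentially. measure (M n) {\<omega> \<in> space (M n).
       \<eta> \<le> dist (emp_cov Cb CW (\<lambda>p. \<theta> n p \<omega>) (nw n) sg x L) ?g} \<le> C * exp (- c * ?v n)"
      using cov_concentration[where x=x, OF net w0 wpos _ half order_refl \<eta>] by auto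
    have "\<forall>\<^sub>F n in sequentially. \<forall>S\<in>sets borel. \<forall>\<beta>.
       (\<forall>q. sym_psd q \<longrightarrow> dist q ?g < \<eta> \<longrightarrow>
          measure std_gauss {r :: real^('a \<times> 'k). sqrt (a n) *\<^sub>R mat_act (psd_sqrt q) r \<in> S} \<le> \<beta>) \<longrightarrow>
       measure (?\<mu> n) S \<le> \<beta> + C * exp (- c * ?v n)"
      using ev
    proof (eventually_elim, intro ballI allI impI)
      fix n and S :: "(real^('a \<times> 'k)) set" and \<beta> :: real
      assume conc: "measure (M n) {\<omega> \<in> space (M n).
          \<eta> \<le> dist (emp_cov Cb CW (\<lambda>p. \<theta> n p \<omega>) (nw n) sg x L) ?g} \<le> C * exp (- c * ?v n)"
        and S: "S \<in> sets borel"
        and \<beta>: "\<forall>q. sym_psd q \<longrightarrow> dist q ?g < \<eta> \<longrightarrow>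
          measure std_gauss {r :: real^('a \<times> 'k). sqrt (a n) *\<^sub>R mat_act (psd_sqrt q) r \<in> S} \<le> \<beta>"
      interpret gaussian_network "M n" "\<theta> n" L "nw n" Cb CW B sg x by (rule net)
      have "measure (?\<mu> n) S = prob {\<omega> \<in> space (M n). sqrt (a n) *\<^sub>R net_output idx \<omega> \<in> S}"
        unfolding out using out_m S
        by (subst measure_distr) (auto intro!: arg_cong2[where f=measure])
      also have "\<dots> \<le> \<beta> + prob {\<omega> \<in> space (M n). \<eta> \<le> dist (cov (\<lambda>p. \<theta> n p \<omega>) L) ?g}"
        using \<beta> by (intro output_mixture_bound idx' S \<eta> g) auto
      finally show "measure (?\<mu> n) S \<le> \<beta> + C * exp (- c * ?v n)" using conc by linarith
    qed
    then show "\<exists>C c. c > 0 \<and> (\<forall>\<^sub>F n in sequentially. \<forall>S\<in>sets borel. \<forall>\<beta>.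
       (\<forall>q. sym_psd q \<longrightarrow> dist q ?g < \<eta> \<longrightarrow>
          measure std_gauss {r :: real^('a \<times> 'k). sqrt (a n) *\<^sub>R mat_act (psd_sqrt q) r \<in> S} \<le> \<beta>) \<longrightarrow>
       measure (?\<mu> n) S \<le> \<beta> + C * exp (- c * ?v n))" using c by blast
  qed
  \<comment> \<open>The inverse of \<open>s ** s\<close> times \<open>s\<close> is a left inverse of
    \<open>s\<close>, which suffices for a square matrix.\<close>
  have inv: "invertible (psd_sqrt ?g)" if "invertible ?g"
  proof -
    have "(matrix_inv ?g ** psd_sqrt ?g) ** psd_sqrt ?g = mat 1"
      using matrix_inv_left[OF that] psd_sqrt_mult_self[OF g] by (simp flip: matrix_mul_assoc)
    then show ?thesis unfolding invertible_left_inverse by blast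
  qed
  show "let G = psd_sqrt ?g;
       I = (\<lambda>z::real^('a \<times> 'k). INF r \<in> {r. mat_act G r = z}. ereal (norm r ^ 2 / 2))
     in LDP ?\<mu> (\<lambda>n. 1 / a n) I \<and> good_rate_function I \<and>
        (invertible ?g \<longrightarrow> (\<forall>z. I z = ereal (norm (mat_act (matrix_inv G) z) ^ 2 / 2)))"
    unfolding Let_def gauss_rate_def[symmetric]
    using ldp good_rate_function_gauss_rate gauss_rate_invertible inv by blast
qed

end
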